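(* Let $\Gamma=(V,\rho,a,B)$ be any infinite network, with edge parameters $R_{xy},L_{xy},D_{xy}$ and partial effective admittances $\mathcal{P}_n(\lambda)$, $n\ge 1$. Then the following holds. (a) The sequence $\{\mathcal{P}_n(\lambda)\}$ converges as $n\to\infty$ locally uniformly in the domain $\{\lambda\in\mathbb{C} : \operatorname{Re}\lambda>0\}$. (b) If $L_{xy}>0$ for all $xy\in E$ and $$S_D:=\sup_{xy\in E}\frac{D_{xy}}{L_{xy}}<\infty,\qquad S_R:=\sup_{xy\in E}\frac{R_{xy}}{L_{xy}}<\infty,$$ then $\{\mathcal{P}_n(\lambda)\}$ converges as $n\to\infty$ locally uniformly in the domain $$\Omega=\{\lambda\in\mathbb{C} : \operatorname{Im}\lambda\neq 0 \text{ and } |\lambda|^2>S_D\}.$$ (c) If, in addition to the hypotheses of (b), also $$S_D^{*}:=\inf_{xy\in E}\frac{D_{xy}}{L_{xy}}>0,$$ then $\{\mathcal{P}_n(\lambda)\}$ converges as $n\to\infty$ locally uniformly in the domain $$\Omega^{*}=\{\lambda\in\mathbb{C} : \operatorname{Im}\lambda\neq 0 \text{ and } |\lambda|^2<S_D^{*}\}.$$ In all the cases, the limit $\mathcal{P}(\lambda)=\lim_{n\to\infty}\mathcal{P}_n(\lambda)$ is a holomorphic function in the domain in question.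
   Context: Edge weights. Let $(V,E)$ be a connected undirected graph, edges being unordered pairs $xy$ of vertices; $x\sim y$ means $xy\in E$. Each edge $xy\in E$ carries real numbers $R_{xy},L_{xy},D_{xy}\in[0,+\infty)$ (resistance, inductance, inverse capacitance) with $R_{xy}+L_{xy}+D_{xy}>0$. For $\lambda\in\mathbb{C}\setminus\{0\}$ the impedance of the edge is $z_{xy}^{(\lambda)}=R_{xy}+L_{xy}\lambda+\frac{D_{xy}}{\lambda}$ and the admittance is $\rho_{xy}^{(\lambda)}=1/z_{xy}^{(\lambda)}$. Set $\rho_{xy}^{(\lambda)}=0$ if $x\not\sim y$. Finite networks. Suppose $(V,E)$ is finite, $|V|\ge2$, $a\in V$, $B\subset V$ is non-empty and $a\notin B$; put $B_0=B\cup\{a\}$. Then $(V,\rho,a,B)$ is called a finite network. Let $\Lambda$ be the set of those $\lambda\in\mathbb{C}\setminus\{0\}$ with $L_{xy}\lambda^2+R_{xy}\lambda+D_{xy}\ne0$ for all $xy\in E$ (so that all $\rho^{(\lambda)}_{xy}$ on edges are in $\mathbb{C}\setminus\{0\}$); $\Lambda\supset\{\operatorname{Re}\lambda>0\}$. For $\lambda\in\Lambda$ put $\Delta_\rho f(x)=\sum_{y\in V}(f(y)-f(x))\rho_{xy}^{(\lambda)}$ for $f:V\to\mathbb{C}$, and consider the Dirichlet problem for $v:V\to\mathbb{C}$: $\Delta_\rho v(x)=0$ for $x\in V\setminus B_0$, $v(x)=0$ for $x\in B$, $v(a)=1$. The effective admittance is $\mathcal{P}(\lambda)=\sum_{x\in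 V}(1-v(x))\rho_{xa}^{(\lambda)}$ where $v$ is any solution (the value does not depend on the choice of the solution); if there is no solution, $\mathcal{P}(\lambda)=\infty$. Infinite networks. Suppose $(V,E)$ is infinite, locally finite and connected, each edge $xy\in E$ carrying real numbers $R_{xy},L_{xy},D_{xy}\in[0,+\infty)$ with $R_{xy}+L_{xy}+D_{xy}>0$ and the admittance $\rho_{xy}^{(\lambda)}=1/\left(R_{xy}+L_{xy}\lambda+\frac{D_{xy}}{\lambda}\right)$ (with $\rho_{xy}^{(\lambda)}=0$ if $x\not\sim y$), $a\in V$, and $B\subset V$ is a (possibly empty) set with $a\notin B$. Then $\Gamma=(V,\rho,a,B)$ is called an infinite network. With $\operatorname{dist}$ the graph distance, for $n\ge1$ put $V_n=\{x\in V:\operatorname{dist}(a,x)\le n\}$, let $E_n$ be the set of edges of $E$ with both endpoints in $V_n$, $\rho_n=\rho|_{E_n}$, $\partial V_n=\{x\in V:\operatorname{dist}(a,x)=n\}$, $B_n=(B\cap V_n)\cup\partial V_n$. Then $\mathcal{P}_n(\lambda)$ denotes the effective admittance of the finite network $\Gamma_n=(V_n,\rho_n,a,B_n)$, and the effective admittance of $\Gamma$ is $\mathcal{P}(\lambda)=\lim_{n\to\infty}\mathcal{P}_n(\lambda)$ for those $\lambda\in\mathbb{C}\setminus\{0\}$ where the limit exists. *)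

theory Defs
  imports "HOL-Complex_Analysis.Complex_Analysis"
begin

text \<open>
  An edge is the set \<open>{x, y}\<close> of its endpoints, so edge weights are symmetric by construction.
  Loops \<open>{x}\<close> are not excluded; they contribute nothing to the Laplacian or to the
  effective admittance.
\<close>

definition adj :: "'a set set \<Rightarrow> ('a \<times> 'a) set" where
  "adj E = {(x, y). {x, y} \<in> E}"

definition graph_dist :: "'a set set \<Rightarrow> 'a \<Rightarrow> 'a \<Rightarrow> nat" where
  "graph_dist E x y = (LEAST n. (x, y) \<in> adj E ^^ n)"

locale weighted_graph =
  fixes V :: "'a set" and E :: "'a set set" and R L D :: "'a set \<Rightarrow> real"
  assumes edges: "E \<subseteq> {{x, y} |x y. x \<in> V \<and> y \<in> V}"
    and connected: "\<And>x y. x \<in> V \<Longrightarrow> y \<in> V \<Longrightarrow> (x, y) \<in> (adj E)\<^sup>*"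
    and nonneg: "\<And>e. e \<in> E \<Longrightarrow> 0 \<le> R e \<and> 0 \<le> L e \<and> 0 \<le> D e"
    and nonzero: "\<And>e. e \<in> E \<Longrightarrow> R e + L e + D e > 0"

locale finite_network = weighted_graph +
  fixes a :: 'a and B :: "'a set"
  assumes finite_V: "finite V"
    and card_V: "2 \<le> card V"
    and a_in_V: "a \<in> V"
    and B_subset: "B \<subseteq> V"
    and B_nonempty: "B \<noteq> {}"
    and a_notin_B: "a \<notin> B"

locale infinite_network = weighted_graph +
  fixes a :: 'a and B :: "'a set"
  assumes infinite_V: "infinite V"
    and locally_finite: "\<And>x. x \<in> V \<Longrightarrow> finite {y. {x, y} \<in> E}"
    and a_in_V: "a \<in> V"
    and B_subset: "B \<subseteq> V"
    and a_notin_B: "a \<notin> B"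

definition impedance ::
  "('a set \<Rightarrow> real) \<Rightarrow> ('a set \<Rightarrow> real) \<Rightarrow> ('a set \<Rightarrow> real) \<Rightarrow> complex \<Rightarrow> 'a set \<Rightarrow> complex" where
  "impedance R L D z e = of_real (R e) + of_real (L e) * z + of_real (D e) / z"

definition admittance ::
  "'a set set \<Rightarrow> ('a set \<Rightarrow> real) \<Rightarrow> ('a set \<Rightarrow> real) \<Rightarrow> ('a set \<Rightarrow> real) \<Rightarrow> complex \<Rightarrow>
    'a \<Rightarrow> 'a \<Rightarrow> complex" where
  "admittance E R L D z x y = (if {x, y} \<in> E then 1 / impedance R L D z {x, y} else 0)"

text \<open>The set \<open>\<Lambda>\<close>.\<close>

definition admissible ::
  "'a set set \<Rightarrow> ('a set \<Rightarrow> real) \<Rightarrow> ('a set \<Rightarrow> real) \<Rightarrow> ('a set \<Rightarrow> real) \<Rightarrow> complex set" where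
  "admissible E R L D =
    {z. z \<noteq> 0 \<and> (\<forall>e\<in>E. of_real (L e) * z\<^sup>2 + of_real (R e) * z + of_real (D e) \<noteq> 0)}"

definition laplacian ::
  "'a set \<Rightarrow> ('a \<Rightarrow> 'a \<Rightarrow> complex) \<Rightarrow> ('a \<Rightarrow> complex) \<Rightarrow> 'a \<Rightarrow> complex" where
  "laplacian V \<rho> f x = (\<Sum>y\<in>V. (f y - f x) * \<rho> x y)"

definition dirichlet_solution ::
  "'a set \<Rightarrow> ('a \<Rightarrow> 'a \<Rightarrow> complex) \<Rightarrow> 'a \<Rightarrow> 'a set \<Rightarrow> ('a \<Rightarrow> complex) \<Rightarrow> bool" where
  "dirichlet_solution V \<rho> a B v \<longleftrightarrow>
    (\<forall>x\<in>V - (B \<union> {a}). laplacian V \<rho> v x = 0) \<and> (\<forall>x\<in>B. v x = 0) \<and> v a = 1"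

definition admittance_of_solution ::
  "'a set \<Rightarrow> ('a \<Rightarrow> 'a \<Rightarrow> complex) \<Rightarrow> 'a \<Rightarrow> ('a \<Rightarrow> complex) \<Rightarrow> complex" where
  "admittance_of_solution V \<rho> a v = (\<Sum>x\<in>V. (1 - v x) * \<rho> x a)"

text \<open>
  The value \<open>None\<close> stands for \<open>\<infinity>\<close>. The choice of the solution is
  immaterial, see \<open>admittance_of_solution_unique\<close>. The value is meaningful only for
  \<open>z\<close> in the set \<open>admissible E R L D\<close>.
\<close>

definition effective_admittance ::
  "'a set \<Rightarrow> 'a set set \<Rightarrow> ('a set \<Rightarrow> real) \<Rightarrow> ('a set \<Rightarrow> real) \<Rightarrow> ('a set \<Rightarrow> real) \<Rightarrow>
    'a \<Rightarrow> 'a set \<Rightarrow> complex \<Rightarrow> complex option" where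
  "effective_admittance V E R L D a B z =
    (let \<rho> = admittance E R L D z in
      if \<exists>v. dirichlet_solution V \<rho> a B v
      then Some (admittance_of_solution V \<rho> a (SOME v. dirichlet_solution V \<rho> a B v))
      else None)"

lemma admittance_of_solution_unique:
  assumes net: "finite_network V E R L D a B"
    and v: "dirichlet_solution V (admittance E R L D z) a B v"
    and w: "dirichlet_solution V (admittance E R L D z) a B w"
  shows "admittance_of_solution V (admittance E R L D z) a v =
    admittance_of_solution V (admittance E R L D z) a w"
proof -
  interpret finite_network V E R L D a B by (fact net)
  define \<rho> where "\<rho> = admittance E R L D z"
  have sym: "\<rho> x y = \<rho> y x" for x y
    by (simp add: \<rho>_def admittance_def insert_commute)
  have as_laplacian: "admittance_of_solution V \<rho> a u = - laplacian V \<rho> u a" if "u a = 1" for u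
    unfolding admittance_of_solution_def laplacian_def that sum_negf[symmetric]
    by (rule sum.cong) (auto simp: sym algebra_simps)
  have v1: "v a = 1" and w1: "w a = 1"
    using v w by (auto simp: dirichlet_solution_def)
  have pointwise: "v x * laplacian V \<rho> w x - w x * laplacian V \<rho> v x =
      (\<Sum>y\<in>V. (v x * w y - w x * v y) * \<rho> x y)" for x
    unfolding laplacian_def sum_distrib_left sum_subtractf[symmetric]
    by (rule sum.cong) (auto simp: algebra_simps)
  have "(\<Sum>x\<in>V. v x * laplacian V \<rho> w x - w x * laplacian V \<rho> v x) =
      (\<Sum>x\<in>V. \<Sum>y\<in>V. v x * w y * \<rho> x y) - (\<Sum>x\<in>V. \<Sum>y\<in>V. w x * v y * \<rho> x y)"
    unfolding pointwise by (simp add: sum_subtractf left_diff_distrib)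
  also have "(\<Sum>x\<in>V. \<Sum>y\<in>V. w x * v y * \<rho> x y) = (\<Sum>x\<in>V. \<Sum>y\<in>V. v x * w y * \<rho> x y)"
    by (subst sum.swap) (auto intro!: sum.cong simp: sym)
  finally have "(\<Sum>x\<in>V. v x * laplacian V \<rho> w x - w x * laplacian V \<rho> v x) = 0"
    by simp
  moreover have "v x * laplacian V \<rho> w x - w x * laplacian V \<rho> v x =
      (if x = a then laplacian V \<rho> w a - laplacian V \<rho> v a else 0)" if "x \<in> V" for x
    using v w that by (cases "x \<in> B") (auto simp: dirichlet_solution_def \<rho>_def)
  ultimately have "laplacian V \<rho> w a - laplacian V \<rho> v a = 0"
    using finite_V a_in_V by simp
  then show ?thesis
    using as_laplacian[of v] as_laplacian[of w] v1 w1 by (simp add: \<rho>_def)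
qed

definition graph_ball :: "'a set \<Rightarrow> 'a set set \<Rightarrow> 'a \<Rightarrow> nat \<Rightarrow> 'a set" where
  "graph_ball V E a n = {x \<in> V. graph_dist E a x \<le> n}"

definition graph_sphere :: "'a set \<Rightarrow> 'a set set \<Rightarrow> 'a \<Rightarrow> nat \<Rightarrow> 'a set" where
  "graph_sphere V E a n = {x \<in> V. graph_dist E a x = n}"

definition ball_edges :: "'a set \<Rightarrow> 'a set set \<Rightarrow> 'a \<Rightarrow> nat \<Rightarrow> 'a set set" where
  "ball_edges V E a n = {e \<in> E. e \<subseteq> graph_ball V E a n}"

definition ball_boundary :: "'a set \<Rightarrow> 'a set set \<Rightarrow> 'a \<Rightarrow> 'a set \<Rightarrow> nat \<Rightarrow> 'a set" where
  "ball_boundary V E a B n = (B \<inter> graph_ball V E a n) \<union> graph_sphere V E a n"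

text \<open>The truncations of an infinite network are finite networks.\<close>

lemma (in infinite_network) truncation_is_finite_network:
  assumes n: "1 \<le> n"
  shows "finite_network (graph_ball V E a n) (ball_edges V E a n) R L D a (ball_boundary V E a B n)"
proof -
  have adj_V: "x \<in> V" "y \<in> V" if "(x, y) \<in> adj E" for x y
    using that edges by (fastforce simp: adj_def doubleton_eq_iff)+
  have path: "(a, x) \<in> adj E ^^ graph_dist E a x" if "x \<in> V" for x
    using connected[OF a_in_V that] unfolding graph_dist_def rtrancl_power by (rule LeastI_ex)
  have dist_le: "graph_dist E a x \<le> m" if "(a, x) \<in> adj E ^^ m" for x m
    using that unfolding graph_dist_def by (rule Least_le)
  have dist_a: "graph_dist E a a = 0"
    using dist_le[of a 0] by simp
  have pred: "\<exists>y\<in>V. (y, x) \<in> adj E \<and> graph_dist E a y \<le> m"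
    if "x \<in> V" "graph_dist E a x = Suc m" for x m
  proof -
    have "(a, x) \<in> adj E ^^ Suc m" using path[OF that(1)] that(2) by simp
    then obtain y where "(a, y) \<in> adj E ^^ m" "(y, x) \<in> adj E" by auto
    then show ?thesis using adj_V(1) dist_le by blast
  qed
  have fin: "finite (graph_ball V E a m)" for m
  proof (induction m)
    case 0
    have "graph_ball V E a 0 \<subseteq> {a}"
    proof
      fix x assume "x \<in> graph_ball V E a 0"
      then show "x \<in> {a}" using path[of x] by (simp add: graph_ball_def)
    qed
    then show ?case by (rule finite_subset) simp
  next
    case (Suc m)
    have "graph_ball V E a (Suc m) \<subseteq>
        graph_ball V E a m \<union> (\<Union>y\<in>graph_ball V E a m. {x. {y, x} \<in> E})"
    proof
      fix x assume x: "x \<in> graph_ball V E a (Suc m)"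
      show "x \<in> graph_ball V E a m \<union> (\<Union>y\<in>graph_ball V E a m. {x. {y, x} \<in> E})"
      proof (cases "graph_dist E a x = Suc m")
        case True
        then show ?thesis
          using pred[of x m] x by (auto simp: graph_ball_def adj_def)
      qed (use x in \<open>auto simp: graph_ball_def\<close>)
    qed
    moreover have "finite \<dots>"
      using Suc.IH locally_finite by (auto simp: graph_ball_def)
    ultimately show ?case by (rule finite_subset)
  qed
  obtain x where x: "x \<in> V" "n < graph_dist E a x"
  proof -
    have "\<not> V \<subseteq> graph_ball V E a n"
      using fin[of n] infinite_V finite_subset by blast
    then show thesis using that by (force simp: graph_ball_def not_le)
  qed
  obtain y where y: "y \<in> graph_sphere V E a n"
  proof -
    define k where "k = graph_dist E a x - n"
    have k: "graph_dist E a x = n + k" using x by (simp add: k_def)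
    obtain y where y: "(a, y) \<in> adj E ^^ n" "(y, x) \<in> adj E ^^ k"
      using path[OF x(1)] unfolding k relpow_add by blast
    have "y \<in> V"
      using y(1) n adj_V(2) by (cases n) auto
    moreover have "(a, x) \<in> adj E ^^ (graph_dist E a y + k)"
      using path[OF \<open>y \<in> V\<close>] y(2) unfolding relpow_add by blast
    from dist_le[OF this] have "graph_dist E a y = n"
      using dist_le[OF y(1)] k by simp
    ultimately show thesis using that[of y] by (simp add: graph_sphere_def)
  qed
  have symm: "sym (adj (ball_edges V E a n))"
    by (auto simp: sym_def adj_def insert_commute)
  have conn_a: "(a, x) \<in> (adj (ball_edges V E a n))\<^sup>*" if "x \<in> graph_ball V E a n" for x
    using that
  proof (induction "graph_dist E a x" arbitrary: x rule: less_induct)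
    case less
    show ?case
    proof (cases "graph_dist E a x")
      case 0
      then show ?thesis using path[of x] less.prems by (simp add: graph_ball_def)
    next
      case (Suc m)
      then obtain y where y: "y \<in> V" "(y, x) \<in> adj E" "graph_dist E a y \<le> m"
        using pred[of x m] less.prems by (auto simp: graph_ball_def)
      then have "y \<in> graph_ball V E a n"
        using less.prems Suc by (simp add: graph_ball_def)
      moreover have "(y, x) \<in> adj (ball_edges V E a n)"
        using y \<open>y \<in> graph_ball V E a n\<close> less.prems by (simp add: adj_def ball_edges_def)
      ultimately show ?thesis
        using less.hyps[of y] y(3) Suc by (simp add: rtrancl.rtrancl_into_rtrancl)
    qed
  qed
  have ya: "y \<noteq> a" "y \<in> graph_ball V E a n" "a \<in> graph_ball V E a n"
    using y n dist_a a_in_V by (auto simp: graph_sphere_def graph_ball_def)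
  show ?thesis
  proof
    show "ball_edges V E a n \<subseteq> {{x, y} |x y. x \<in> graph_ball V E a n \<and> y \<in> graph_ball V E a n}"
    proof
      fix e assume e: "e \<in> ball_edges V E a n"
      then obtain u w where "e = {u, w}" using edges by (auto simp: ball_edges_def)
      then show "e \<in> {{x, y} |x y. x \<in> graph_ball V E a n \<and> y \<in> graph_ball V E a n}"
        using e by (auto simp: ball_edges_def)
    qed
    show "(u, w) \<in> (adj (ball_edges V E a n))\<^sup>*"
      if "u \<in> graph_ball V E a n" "w \<in> graph_ball V E a n" for u w
      using conn_a[OF that(1)] conn_a[OF that(2)] sym_rtrancl[OF symm]
      by (meson rtrancl_trans symD)
    show "2 \<le> card (graph_ball V E a n)"
      using card_mono[OF fin, of "{y, a}" n] ya by simp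
  qed (use fin nonneg nonzero ya y n dist_a a_notin_B in
      \<open>auto simp: ball_edges_def ball_boundary_def graph_sphere_def graph_ball_def\<close>)
qed

definition partial_admittance ::
  "'a set \<Rightarrow> 'a set set \<Rightarrow> ('a set \<Rightarrow> real) \<Rightarrow> ('a set \<Rightarrow> real) \<Rightarrow> ('a set \<Rightarrow> real) \<Rightarrow>
    'a \<Rightarrow> 'a set \<Rightarrow> nat \<Rightarrow> complex \<Rightarrow> complex option" where
  "partial_admittance V E R L D a B n =
    effective_admittance (graph_ball V E a n) (ball_edges V E a n) R L D a (ball_boundary V E a B n)"

text \<open>Only meaningful where the partial admittances are finite and their limit exists.\<close>

definition limit_admittance ::
  "'a set \<Rightarrow> 'a set set \<Rightarrow> ('a set \<Rightarrow> real) \<Rightarrow> ('a set \<Rightarrow> real) \<Rightarrow> ('a set \<Rightarrow> real) \<Rightarrow>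
    'a \<Rightarrow> 'a set \<Rightarrow> complex \<Rightarrow> complex" where
  "limit_admittance V E R L D a B z = lim (\<lambda>n. the (partial_admittance V E R L D a B n z))"

text \<open>
  The first conjunct says that the partial admittances are genuine complex-valued functions on
  \<open>\<Omega>\<close>: every \<open>z\<close> in \<open>\<Omega>\<close> is admissible for the \<open>n\<close>-th finite network and the value there is
  not \<open>\<infinity>\<close>.
\<close>

definition admittances_converge_locally_uniformly_on ::
  "complex set \<Rightarrow> 'a set \<Rightarrow> 'a set set \<Rightarrow> ('a set \<Rightarrow> real) \<Rightarrow> ('a set \<Rightarrow> real) \<Rightarrow>
    ('a set \<Rightarrow> real) \<Rightarrow> 'a \<Rightarrow> 'a set \<Rightarrow> bool" where
  "admittances_converge_locally_uniformly_on \<Omega> V E R L D a B \<longleftrightarrow>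
    (\<forall>n\<ge>1. \<forall>z\<in>\<Omega>. z \<in> admissible (ball_edges V E a n) R L D \<and>
      partial_admittance V E R L D a B n z \<noteq> None) \<and>
    (\<forall>z\<in>\<Omega>. \<exists>r>0. cball z r \<subseteq> \<Omega> \<and>
      uniform_limit (cball z r) (\<lambda>n w. the (partial_admittance V E R L D a B n w))
        (limit_admittance V E R L D a B) sequentially)"

end

theory Submission
  imports Defs
begin

text \<open>
The theorem rests on Vitali's principle (\<open>vitali_convergence\<close>): a locally bounded sequence of
holomorphic functions on a connected open set converges locally uniformly as soon as it converges
on a set with an accumulation point in it. So three things are needed: each \<open>\<P>\<^sub>n\<close> is holomorphic, the
\<open>\<P>\<^sub>n\<close> are locally bounded uniformly in \<open>n\<close>, and they converge on some accumulating set.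

In all three parts the impedances of all edges lie in one common sector of opening less than \<open>\<pi>\<close>, at
each fixed \<open>\<lambda>\<close>. In the right half plane this is because \<open>1\<close>, \<open>\<lambda>\<close> and \<open>1 / \<lambda>\<close> lie in such a sector
(\<open>sectorial_right_half_plane\<close>). In the regions of (b) and (c) the imaginary parts
\<open>Im \<lambda> * (L - D / (cmod \<lambda>)\<^sup>2)\<close> have the same sign for all edges and are comparable to \<open>L\<close>, as are the
moduli of the impedances (\<open>sectorial_half_region\<close>).
By Green's identity the effective admittance equals the energy \<open>\<Sum>xy. (cmod (v x - v y))\<^sup>2 * \<rho> x y\<close>
over the edges, a sum of numbers from a sector, which cannot cancel (\<open>energy_le\<close>). This has two consequences.
First, a function of zero energy is constant; therefore the Dirichlet problem is solvable, and its
solution depends holomorphically on \<open>\<lambda>\<close> (\<open>holomorphic_dirichlet_family\<close>). Second, the energy is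
bounded by the modulus of the admittance, which in turn is a sum over the edges at \<open>a\<close>; this gives a
bound on \<open>\<P>\<^sub>n\<close> by the weights at \<open>a\<close> alone, uniform in \<open>n\<close> (\<open>admittance_bound\<close>).

For \<open>\<lambda> > 0\<close> the weights are positive, and by Dirichlet's principle the \<open>\<P>\<^sub>n(\<lambda>)\<close> are nonnegative and
decrease with \<open>n\<close> (\<open>real_admittance_antimono\<close>), so they converge; this gives (a). Each of the two
components of the regions in (b) and (c) meets the right half plane in a nonempty open set, where the
convergence is known from (a), and Vitali's principle applies again.
\<close>

section \<open>Energy of a function on a weighted graph\<close>

lemma green_identity:
  assumes sym: "\<And>x y. x \<in> W \<Longrightarrow> y \<in> W \<Longrightarrow> \<rho> x y = \<rho> y x"
  shows "(\<Sum>x\<in>W. g x * laplacian W \<rho> f x) =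
    - (\<Sum>x\<in>W. \<Sum>y\<in>W. (f x - f y) * (g x - g y) * \<rho> x y) / 2"
proof -
  define A where "A = (\<Sum>x\<in>W. g x * laplacian W \<rho> f x)"
  have A1: "A = (\<Sum>x\<in>W. \<Sum>y\<in>W. g x * (f y - f x) * \<rho> x y)"
    by (simp add: A_def laplacian_def sum_distrib_left mult.assoc)
  also have "\<dots> = (\<Sum>x\<in>W. \<Sum>y\<in>W. g y * (f x - f y) * \<rho> x y)"
    by (subst sum.swap) (intro sum.cong refl, simp add: sym)
  finally have A2: "A = (\<Sum>x\<in>W. \<Sum>y\<in>W. g y * (f x - f y) * \<rho> x y)" .
  have "A + A = (\<Sum>x\<in>W. \<Sum>y\<in>W. g x * (f y - f x) * \<rho> x y + g y * (f x - f y) * \<rho> x y)"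
    by (subst (1) A1, subst A2) (simp add: sum.distrib)
  also have "\<dots> = - (\<Sum>x\<in>W. \<Sum>y\<in>W. (f x - f y) * (g x - g y) * \<rho> x y)"
    unfolding sum_negf[symmetric] by (intro sum.cong refl) (simp add: algebra_simps)
  finally show ?thesis by (simp add: A_def field_simps)
qed

text \<open>
The right-hand side is, up to sign, the complex power of the voltage \<open>u\<close>: every edge contributes a
nonnegative multiple of its own admittance, so information about the arguments of the admittances
passes to the whole sum.
\<close>
lemma green_identity_cnj:
  assumes "\<And>x y. x \<in> W \<Longrightarrow> y \<in> W \<Longrightarrow> \<rho> x y = \<rho> y x"
  shows "(\<Sum>x\<in>W. cnj (u x) * laplacian W \<rho> u x) =
    - (\<Sum>x\<in>W. \<Sum>y\<in>W. of_real ((cmod (u x - u y))\<^sup>2) * \<rho> x y) / 2"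
  by (subst green_identity[OF assms]) (simp_all add: complex_norm_square del: of_real_power)

lemma laplacian_diff:
  "laplacian W \<rho> (\<lambda>x. f x - g x) x = laplacian W \<rho> f x - laplacian W \<rho> g x"
  by (simp add: laplacian_def algebra_simps sum.distrib sum_subtractf)

lemma laplacian_add_scaled:
  "laplacian W \<rho> (\<lambda>x. f x + c * g x) x = laplacian W \<rho> f x + c * laplacian W \<rho> g x"
  by (simp add: laplacian_def algebra_simps sum.distrib sum_subtractf sum_distrib_left)

lemma laplacian_cong:
  assumes "\<And>y. y \<in> W \<Longrightarrow> \<rho> x y = \<rho>' x y" "\<And>y. y \<in> W \<Longrightarrow> f y = g y" "f x = g x"
  shows "laplacian W \<rho> f x = laplacian W \<rho>' g x"
  unfolding laplacian_def using assms by (intro sum.cong) auto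

lemma admittance_eq_laplacian:
  assumes "\<And>x. x \<in> W \<Longrightarrow> \<rho> x a = \<rho> a x" "v a = 1"
  shows "admittance_of_solution W \<rho> a v = - laplacian W \<rho> v a"
  unfolding admittance_of_solution_def laplacian_def sum_negf[symmetric] assms(2)
  by (rule sum.cong) (auto simp: assms(1) algebra_simps)

text \<open>
A solution is harmonic away from \<open>a\<close> and the zero set, so testing its Laplacian against a function
that vanishes on the zero set only sees the vertex \<open>a\<close>. With \<open>g a = 1\<close> the value is minus the
effective admittance.
\<close>
lemma sum_test_function_laplacian:
  assumes v: "dirichlet_solution W \<rho> a Z v" and fin: "finite W" and a: "a \<in> W"
    and g: "\<And>x. x \<in> W \<inter> Z \<Longrightarrow> x \<noteq> a \<Longrightarrow> g x = 0"
  shows "(\<Sum>x\<in>W. g x * laplacian W \<rho> v x) = g a * laplacian W \<rho> v a"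
proof -
  have "g x * laplacian W \<rho> v x = (if x = a then g a * laplacian W \<rho> v a else 0)"
    if "x \<in> W" for x
    using v g that by (cases "x \<in> Z") (auto simp: dirichlet_solution_def)
  then have "(\<Sum>x\<in>W. g x * laplacian W \<rho> v x) =
      (\<Sum>x\<in>W. if x = a then g a * laplacian W \<rho> v a else 0)"
    by (intro sum.cong) auto
  then show ?thesis using fin a by simp
qed

section \<open>Weights in a sector\<close>

text \<open>
All weights lie in a fixed closed sector of opening less than \<open>\<pi>\<close>, bisected by \<open>cnj \<omega>\<close>: after the
rotation by \<open>\<omega>\<close> their real parts control their moduli. This is the substitute for positivity.
Connectedness is required in the form in which it is used, that a function which does not change
along edges of nonzero weight is constant.
\<close>
locale sectorial_weights =
  fixes W :: "'a set" and \<rho> :: "'a \<Rightarrow> 'a \<Rightarrow> complex" and \<omega> :: complex and K :: real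
  assumes finite_W: "finite W"
    and sym: "\<And>x y. x \<in> W \<Longrightarrow> y \<in> W \<Longrightarrow> \<rho> x y = \<rho> y x"
    and K_pos: "0 < K"
    and unit: "cmod \<omega> = 1"
    and sector: "\<And>x y. x \<in> W \<Longrightarrow> y \<in> W \<Longrightarrow> cmod (\<rho> x y) \<le> K * Re (\<omega> * \<rho> x y)"
    and conn: "\<And>(f :: 'a \<Rightarrow> complex) x y.
      (\<And>x y. x \<in> W \<Longrightarrow> y \<in> W \<Longrightarrow> \<rho> x y \<noteq> 0 \<Longrightarrow> f x = f y) \<Longrightarrow> x \<in> W \<Longrightarrow> y \<in> W \<Longrightarrow> f x = f y"
begin

text \<open>
No cancellation can occur in a sum of numbers from the sector, whence a lower bound on the modulus
of the complex power.
\<close>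
lemma energy_le:
  "(\<Sum>x\<in>W. \<Sum>y\<in>W. (cmod (u x - u y))\<^sup>2 * cmod (\<rho> x y)) \<le>
    2 * K * cmod (\<Sum>x\<in>W. cnj (u x) * laplacian W \<rho> u x)"
proof -
  define T where "T = (\<Sum>x\<in>W. cnj (u x) * laplacian W \<rho> u x)"
  have "(\<Sum>x\<in>W. \<Sum>y\<in>W. of_real ((cmod (u x - u y))\<^sup>2) * \<rho> x y) = - 2 * T"
    using green_identity_cnj[of W \<rho> u] sym by (simp add: T_def)
  then have *: "(\<Sum>x\<in>W. \<Sum>y\<in>W. of_real ((cmod (u x - u y))\<^sup>2) * (\<omega> * \<rho> x y)) = - 2 * (\<omega> * T)"
    by (simp add: sum_distrib_left[symmetric] mult.left_commute[of _ \<omega>] del: of_real_power)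
  have Re_scale: "Re (of_real r * w) = r * Re w" for r w
    by simp
  have "(\<Sum>x\<in>W. \<Sum>y\<in>W. (cmod (u x - u y))\<^sup>2 * cmod (\<rho> x y)) \<le>
      (\<Sum>x\<in>W. \<Sum>y\<in>W. (cmod (u x - u y))\<^sup>2 * (K * Re (\<omega> * \<rho> x y)))"
    by (intro sum_mono mult_left_mono sector) auto
  also have "\<dots> = K * Re (\<Sum>x\<in>W. \<Sum>y\<in>W. of_real ((cmod (u x - u y))\<^sup>2) * (\<omega> * \<rho> x y))"
    unfolding Re_sum sum_distrib_left Re_scale by (intro sum.cong refl) (simp only: mult_ac)
  also have "\<dots> = K * Re (- 2 * (\<omega> * T))"
    by (simp only: *)
  also have "\<dots> \<le> K * cmod (- 2 * (\<omega> * T))"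
    using K_pos by (intro mult_left_mono complex_Re_le_cmod less_imp_le)
  also have "\<dots> = 2 * K * cmod T"
    by (simp add: norm_mult unit)
  finally show ?thesis unfolding T_def .
qed

lemma zero_energy_imp_constant:
  assumes "(\<Sum>x\<in>W. cnj (u x) * laplacian W \<rho> u x) = 0" "x \<in> W" "y \<in> W"
  shows "u x = u y"
proof (rule conn[OF _ assms(2,3)])
  fix x y assume xy: "x \<in> W" "y \<in> W" "\<rho> x y \<noteq> 0"
  have "(\<Sum>x\<in>W. \<Sum>y\<in>W. (cmod (u x - u y))\<^sup>2 * cmod (\<rho> x y)) \<le> 0"
    using energy_le[of u] assms(1) by simp
  then have "(\<Sum>x\<in>W. \<Sum>y\<in>W. (cmod (u x - u y))\<^sup>2 * cmod (\<rho> x y)) = 0"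
    by (intro antisym sum_nonneg) auto
  then have "(\<Sum>y\<in>W. (cmod (u x - u y))\<^sup>2 * cmod (\<rho> x y)) = 0"
    using xy finite_W by (subst (asm) sum_nonneg_eq_0_iff) (auto intro: sum_nonneg)
  then have "(cmod (u x - u y))\<^sup>2 * cmod (\<rho> x y) = 0"
    using xy finite_W by (subst (asm) sum_nonneg_eq_0_iff) auto
  then show "u x = u y" using xy by simp
qed

text \<open>
The admittance \<open>P\<close> is at most \<open>\<Sum>x. cmod (1 - v x) * cmod (\<rho> x a)\<close>, where only edges at \<open>a\<close>
enter, while the energy of these edges is at most \<open>2 * K * cmod P\<close>. Trading one
against the other leaves a bound that involves the star of \<open>a\<close> alone, and hence does not see how
far away the boundary is.
\<close>
lemma admittance_bound:
  assumes v: "dirichlet_solution W \<rho> a Z v" and a: "a \<in> W"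
  shows "cmod (admittance_of_solution W \<rho> a v) \<le> 2 * K * (\<Sum>x\<in>W. cmod (\<rho> x a))"
proof -
  define P where "P = admittance_of_solution W \<rho> a v"
  have va: "v a = 1" and vZ: "\<And>x. x \<in> Z \<Longrightarrow> v x = 0"
    using v by (auto simp: dirichlet_solution_def)
  have P: "P = - laplacian W \<rho> v a"
    unfolding P_def by (rule admittance_eq_laplacian) (auto simp: sym a va)
  have "(\<Sum>x\<in>W. cnj (v x) * laplacian W \<rho> v x) = - P"
    by (subst sum_test_function_laplacian[OF v finite_W a]) (auto simp: va vZ P)
  then have energy: "(\<Sum>x\<in>W. \<Sum>y\<in>W. (cmod (v x - v y))\<^sup>2 * cmod (\<rho> x y)) \<le> 2 * K * cmod P"
    using energy_le[of v] by simp
  have star: "(\<Sum>x\<in>W. (cmod (1 - v x))\<^sup>2 * cmod (\<rho> x a)) \<le> 2 * K * cmod P"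
  proof -
    have "(\<Sum>x\<in>W. (cmod (v x - v a))\<^sup>2 * cmod (\<rho> x a)) \<le>
        (\<Sum>x\<in>W. \<Sum>y\<in>W. (cmod (v x - v y))\<^sup>2 * cmod (\<rho> x y))"
      by (intro sum_mono member_le_sum[of a W "\<lambda>y. (cmod (v _ - v y))\<^sup>2 * cmod (\<rho> _ y)"])
        (auto simp: a finite_W)
    then show ?thesis using energy by (simp add: va norm_minus_commute)
  qed
  \<comment> \<open>the constant is chosen such that the energy term reproduces half of \<open>cmod P\<close>, to be absorbed on the left\<close>
  have amgm: "cmod (1 - v x) * r \<le> (cmod (1 - v x))\<^sup>2 * r / (4 * K) + K * r" if "0 \<le> r" for x r
  proof -
    have "0 \<le> (cmod (1 - v x) - 2 * K)\<^sup>2 * r / (4 * K)"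
      using K_pos that by simp
    also have "\<dots> = (cmod (1 - v x))\<^sup>2 * r / (4 * K) + K * r - cmod (1 - v x) * r"
      using K_pos by (simp add: field_simps power2_eq_square)
    finally show ?thesis by simp
  qed
  have "cmod P \<le> (\<Sum>x\<in>W. cmod (1 - v x) * cmod (\<rho> x a))"
    unfolding P_def admittance_of_solution_def norm_mult[symmetric] by (rule norm_sum)
  also have "\<dots> \<le> (\<Sum>x\<in>W. (cmod (1 - v x))\<^sup>2 * cmod (\<rho> x a) / (4 * K) + K * cmod (\<rho> x a))"
    by (intro sum_mono amgm) auto
  also have "\<dots> = (\<Sum>x\<in>W. (cmod (1 - v x))\<^sup>2 * cmod (\<rho> x a)) / (4 * K) + K * (\<Sum>x\<in>W. cmod (\<rho> x a))"
    by (simp add: sum.distrib sum_divide_distrib sum_distrib_left)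
  also have "\<dots> \<le> (2 * K * cmod P) / (4 * K) + K * (\<Sum>x\<in>W. cmod (\<rho> x a))"
    using star K_pos by (intro add_right_mono divide_right_mono) auto
  also have "\<dots> = cmod P / 2 + K * (\<Sum>x\<in>W. cmod (\<rho> x a))"
    using K_pos by simp
  finally show ?thesis by (simp add: P_def)
qed

end

section \<open>Holomorphic solutions of the Dirichlet problem\<close>

text \<open>
The set \<open>U\<close> of vertices where harmonicity is required grows one vertex at a time. If \<open>h\<close> has the
prescribed boundary values and \<open>k\<close> the boundary values of the indicator of the new vertex \<open>p\<close>, both
harmonic on the old \<open>U\<close>, then \<open>h + t * k\<close> is harmonic at \<open>p\<close> too for a suitable \<open>t\<close>, provided that
the Laplacian of \<open>k\<close> at \<open>p\<close> does not vanish. That Laplacian is the complex power of \<open>k\<close>, and \<open>k\<close> is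
not constant, being \<open>1\<close> at \<open>p\<close> and \<open>0\<close> at the vertices outside. The formula for \<open>t\<close> shows that holomorphic dependence on the parameter is inherited, so
existence and holomorphy are obtained together.
\<close>
lemma holomorphic_dirichlet_family:
  fixes \<rho> :: "complex \<Rightarrow> 'a \<Rightarrow> 'a \<Rightarrow> complex"
  assumes sect: "\<And>z. z \<in> S \<Longrightarrow> sectorial_weights W (\<rho> z) (\<omega> z) (K z)"
    and hol: "\<And>x y. x \<in> W \<Longrightarrow> y \<in> W \<Longrightarrow> (\<lambda>z. \<rho> z x y) holomorphic_on S"
    and "finite U" "U \<subset> W"
  shows "\<exists>v. (\<forall>x. (\<lambda>z. v z x) holomorphic_on S) \<and>
    (\<forall>z\<in>S. \<forall>x\<in>U. laplacian W (\<rho> z) (v z) x = 0) \<and> (\<forall>z x. x \<notin> U \<longrightarrow> v z x = g x)"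
  using \<open>finite U\<close> \<open>U \<subset> W\<close>
proof (induction U arbitrary: g rule: finite_induct)
  case empty
  show ?case by (rule exI[of _ "\<lambda>z. g"]) auto
next
  case (insert p U)
  then have "U \<subset> W" "p \<in> W" by auto
  note IH = insert.IH[OF \<open>U \<subset> W\<close>]
  obtain h where h: "\<And>x. (\<lambda>z. h z x) holomorphic_on S"
      "\<And>z x. z \<in> S \<Longrightarrow> x \<in> U \<Longrightarrow> laplacian W (\<rho> z) (h z) x = 0" "\<And>z x. x \<notin> U \<Longrightarrow> h z x = g x"
    using IH[of g] by blast
  obtain k where k: "\<And>x. (\<lambda>z. k z x) holomorphic_on S"
      "\<And>z x. z \<in> S \<Longrightarrow> x \<in> U \<Longrightarrow> laplacian W (\<rho> z) (k z) x = 0"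
      "\<And>z x. x \<notin> U \<Longrightarrow> k z x = (if x = p then 1 else 0)"
    using IH[of "\<lambda>x. if x = p then 1 else 0"] by blast
  obtain b where b: "b \<in> W" "b \<notin> U" "b \<noteq> p" using insert.prems by auto
  \<comment> \<open>every other summand of the complex power of \<open>k\<close> vanishes: \<open>k\<close> is harmonic on \<open>U\<close> and zero elsewhere\<close>
  have nz: "laplacian W (\<rho> z) (k z) p \<noteq> 0" if z: "z \<in> S" for z
  proof
    assume 0: "laplacian W (\<rho> z) (k z) p = 0"
    have "cnj (k z x) * laplacian W (\<rho> z) (k z) x = 0" for x
      using 0 k(2)[OF z, of x] k(3)[of x z] by (cases "x \<in> U"; cases "x = p") auto
    then have "(\<Sum>x\<in>W. cnj (k z x) * laplacian W (\<rho> z) (k z) x) = 0"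
      by (intro sum.neutral ballI)
    from sectorial_weights.zero_energy_imp_constant[OF sect[OF z] this \<open>p \<in> W\<close> b(1)]
    show False using k(3) b insert.hyps(2) by simp
  qed
  have hol_lap: "(\<lambda>z. laplacian W (\<rho> z) (f z) p) holomorphic_on S"
    if "\<And>x. (\<lambda>z. f z x) holomorphic_on S" for f
    unfolding laplacian_def using \<open>p \<in> W\<close> that hol by (intro holomorphic_intros) auto
  define t where "t z = - laplacian W (\<rho> z) (h z) p / laplacian W (\<rho> z) (k z) p" for z
  have "t holomorphic_on S"
    unfolding t_def[abs_def] using nz h k hol_lap by (intro holomorphic_intros) auto
  then have "(\<lambda>z. h z x + t z * k z x) holomorphic_on S" for x
    using h(1) k(1) by (intro holomorphic_intros)
  moreover have "laplacian W (\<rho> z) (\<lambda>x. h z x + t z * k z x) x = 0"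
    if "z \<in> S" "x \<in> insert p U" for z x
    using that h(2)[OF that(1)] k(2)[OF that(1)] nz[OF that(1)]
    unfolding laplacian_add_scaled by (cases "x = p") (auto simp: t_def)
  moreover have "h z x + t z * k z x = g x" if "x \<notin> insert p U" for z x
    using that h(3) k(3) by simp
  ultimately show ?case
    by (intro exI[of _ "\<lambda>z x. h z x + t z * k z x"]) auto
qed

section \<open>Monotonicity for real weights\<close>

text \<open>
For nonnegative real weights this is Dirichlet's principle: enlarging the zero set shrinks the
set of competitors for the minimal energy. Concretely, the difference of the two admittances is the
energy of the difference of the two potentials.
\<close>
lemma real_admittance_antimono:
  fixes c :: "'a \<Rightarrow> 'a \<Rightarrow> real"
  assumes fin: "finite W" and sym: "\<And>x y. x \<in> W \<Longrightarrow> y \<in> W \<Longrightarrow> c x y = c y x"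
    and nn: "\<And>x y. x \<in> W \<Longrightarrow> y \<in> W \<Longrightarrow> 0 \<le> c x y" and a: "a \<in> W"
    and v: "dirichlet_solution W (\<lambda>x y. of_real (c x y)) a Z v"
    and v': "dirichlet_solution W (\<lambda>x y. of_real (c x y)) a Z' v'"
    and ZZ': "Z \<subseteq> Z'"
  defines "P \<equiv> admittance_of_solution W (\<lambda>x y. of_real (c x y)) a"
  shows "P v \<in> \<real>" "0 \<le> Re (P v)" "Re (P v) \<le> Re (P v')"
proof -
  let ?\<rho> = "\<lambda>x y. complex_of_real (c x y)"
  let ?lap = "laplacian W ?\<rho>"
  have sym': "?\<rho> x y = ?\<rho> y x" if "x \<in> W" "y \<in> W" for x y
    using sym that by simp
  define Q where "Q u = (\<Sum>x\<in>W. \<Sum>y\<in>W. (cmod (u x - u y))\<^sup>2 * c x y) / 2" for u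
  have Q: "(\<Sum>x\<in>W. cnj (u x) * ?lap u x) = - of_real (Q u)" for u
    by (subst green_identity_cnj[OF sym']) (simp_all add: Q_def)
  have Q_nonneg: "0 \<le> Q u" for u
    unfolding Q_def by (intro divide_nonneg_pos sum_nonneg mult_nonneg_nonneg) (auto simp: nn)
  have P_lap: "P u = - ?lap u a" if "u a = 1" for u
    unfolding P_def using sym a that by (intro admittance_eq_laplacian) auto
  have ds: "v a = 1" "v' a = 1" "\<And>x. x \<in> Z \<Longrightarrow> v x = 0" "\<And>x. x \<in> Z' \<Longrightarrow> v' x = 0"
    using v v' by (auto simp: dirichlet_solution_def)
  have PQ: "P v = of_real (Q v)"
    using Q[of v] sum_test_function_laplacian[OF v fin a, of "\<lambda>x. cnj (v x)"] ds P_lap[of v]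
    by (simp add: minus_equation_iff[of "of_real _"])
  then show "P v \<in> \<real>" "0 \<le> Re (P v)"
    using Q_nonneg by auto
  have PQ': "P v' = of_real (Q v')"
    using Q[of v'] sum_test_function_laplacian[OF v' fin a, of "\<lambda>x. cnj (v' x)"] ds P_lap[of v']
    by (simp add: minus_equation_iff[of "of_real _"])
  define w where "w x = v' x - v x" for x
  have "(\<Sum>x\<in>W. cnj (w x) * ?lap w x) =
      (\<Sum>x\<in>W. cnj (w x) * ?lap v' x) - (\<Sum>x\<in>W. cnj (w x) * ?lap v x)"
    unfolding w_def[abs_def] laplacian_diff by (simp add: algebra_simps sum_subtractf sum.distrib)
  also have "(\<Sum>x\<in>W. cnj (w x) * ?lap v x) = 0"
    using sum_test_function_laplacian[OF v fin a, of "\<lambda>x. cnj (w x)"] ds ZZ' by (auto simp: w_def)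
  also have "(\<Sum>x\<in>W. cnj (w x) * ?lap v' x) =
      (\<Sum>x\<in>W. cnj (v' x) * ?lap v' x) - (\<Sum>x\<in>W. cnj (v x) * ?lap v' x)"
    by (simp add: w_def algebra_simps sum_subtractf)
  \<comment> \<open>the Laplacian is symmetric, and \<open>v'\<close>, unlike \<open>v\<close>, vanishes on both zero sets\<close>
  also have "(\<Sum>x\<in>W. cnj (v x) * ?lap v' x) = (\<Sum>x\<in>W. v' x * ?lap (\<lambda>x. cnj (v x)) x)"
    by (subst (1 2) green_identity[OF sym']) (auto simp: mult.commute mult.left_commute)
  also have "\<dots> = cnj (\<Sum>x\<in>W. cnj (v' x) * ?lap v x)"
    by (simp add: laplacian_def)
  also have "(\<Sum>x\<in>W. cnj (v' x) * ?lap v x) = ?lap v a"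
    using sum_test_function_laplacian[OF v fin a, of "\<lambda>x. cnj (v' x)"] ds ZZ' by auto
  finally have "- of_real (Q w) = - P v' + cnj (P v)"
    unfolding Q using PQ' P_lap[of v] ds by simp
  then have "Re (P v') - Re (P v) = Q w"
    by (metis (no_types, lifting) PQ PQ' Re_complex_of_real complex_cnj_complex_of_real minus_diff_eq
        neg_equal_iff_equal of_real_diff uminus_add_conv_diff)
  then show "Re (P v) \<le> Re (P v')"
    using Q_nonneg[of w] by simp
qed

section \<open>Vitali convergence theorem\<close>

text \<open>
Montel's theorem extracts locally uniformly convergent subsequences. Any two subsequential limits
agree on \<open>T\<close>, hence everywhere by the identity theorem; so a subsequence staying away from the
first limit on some compact set, which would have a further convergent subsequence, cannot exist.
\<close>
theorem vitali_convergence: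
  fixes f :: "nat \<Rightarrow> complex \<Rightarrow> complex"
  assumes S: "open S" "connected S"
    and hol: "\<And>n. f n holomorphic_on S"
    and bdd: "\<And>C. compact C \<Longrightarrow> C \<subseteq> S \<Longrightarrow> \<exists>M. \<forall>n. \<forall>z\<in>C. cmod (f n z) \<le> M"
    and T: "T \<subseteq> S" "\<xi> \<in> S" "\<xi> islimpt T"
    and conv: "\<And>z. z \<in> T \<Longrightarrow> convergent (\<lambda>n. f n z)"
  obtains g where "g holomorphic_on S"
    "\<And>C. compact C \<Longrightarrow> C \<subseteq> S \<Longrightarrow> uniform_limit C f g sequentially"
proof -
  have montel: "\<exists>g r. g holomorphic_on S \<and> strict_mono (r :: nat \<Rightarrow> nat) \<and>
      (\<forall>x\<in>S. (\<lambda>n. f (s (r n)) x) \<longlonglongrightarrow> g x) \<and>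
      (\<forall>C. compact C \<longrightarrow> C \<subseteq> S \<longrightarrow> uniform_limit C (\<lambda>n. f (s (r n))) g sequentially)"
    for s :: "nat \<Rightarrow> nat"
  proof -
    obtain g r where "g holomorphic_on S" "strict_mono (r :: nat \<Rightarrow> nat)"
        "\<And>x. x \<in> S \<Longrightarrow> (\<lambda>n. f (s (r n)) x) \<longlonglongrightarrow> g x"
        "\<And>C. compact C \<Longrightarrow> C \<subseteq> S \<Longrightarrow> uniform_limit C ((\<lambda>n. f (s n)) \<circ> r) g sequentially"
    proof (rule Montel[OF \<open>open S\<close>, of "range f" "\<lambda>n. f (s n)"])
      show "\<exists>M. \<forall>h\<in>range f. \<forall>z\<in>C. cmod (h z) \<le> M" if "compact C" "C \<subseteq> S" for C
        using bdd[OF that] by auto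
    qed (use hol in auto)
    then show ?thesis by (intro exI[of _ g] exI[of _ r]) (auto simp: o_def)
  qed
  obtain g r where g: "g holomorphic_on S" "strict_mono (r :: nat \<Rightarrow> nat)"
      "\<And>x. x \<in> S \<Longrightarrow> (\<lambda>n. f (r n) x) \<longlonglongrightarrow> g x"
    using montel[of id] by auto
  have lim_T: "(\<lambda>n. f n z) \<longlonglongrightarrow> g z" if "z \<in> T" for z
  proof -
    obtain l where l: "(\<lambda>n. f n z) \<longlonglongrightarrow> l"
      using conv[OF \<open>z \<in> T\<close>] by (auto simp: convergent_def)
    then have "(\<lambda>n. f (r n) z) \<longlonglongrightarrow> l"
      using LIMSEQ_subseq_LIMSEQ[OF l g(2)] by (simp add: o_def)
    then show ?thesis
      using l g(3)[of z] T(1) that LIMSEQ_unique by blast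
  qed
  have "uniform_limit C f g sequentially" if C: "compact C" "C \<subseteq> S" for C
  proof (rule ccontr)
    assume "\<not> uniform_limit C f g sequentially"
    then obtain e where e: "e > 0" "\<not> (\<forall>\<^sub>F n in sequentially. \<forall>z\<in>C. dist (f n z) (g z) < e)"
      by (auto simp: uniform_limit_iff)
    then have "infinite {n. \<not> (\<forall>z\<in>C. dist (f n z) (g z) < e)}"
      by (simp add: eventually_cofinite cofinite_eq_sequentially[symmetric])
    then obtain s :: "nat \<Rightarrow> nat" where s: "strict_mono s" "\<And>n. \<not> (\<forall>z\<in>C. dist (f (s n) z) (g z) < e)"
      using infinite_enumerate by blast
    obtain g' r' where g': "g' holomorphic_on S" "strict_mono (r' :: nat \<Rightarrow> nat)"
        "\<And>x. x \<in> S \<Longrightarrow> (\<lambda>n. f (s (r' n)) x) \<longlonglongrightarrow> g' x"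
        "uniform_limit C (\<lambda>n. f (s (r' n))) g' sequentially"
      using montel[of s] C by blast
    have eq_T: "g' z = g z" if "z \<in> T" for z
    proof -
      have "strict_mono (s \<circ> r')" using s(1) g'(2) by (rule strict_mono_o)
      from LIMSEQ_subseq_LIMSEQ[OF lim_T[OF that] this]
      have "(\<lambda>n. f (s (r' n)) z) \<longlonglongrightarrow> g z" by (simp add: o_def)
      then show ?thesis using g'(3)[of z] T(1) that LIMSEQ_unique by blast
    qed
    have "g' z - g z = 0" if "z \<in> S" for z
    proof (rule analytic_continuation[of "\<lambda>z. g' z - g z" S T \<xi> z])
      show "(\<lambda>z. g' z - g z) holomorphic_on S"
        using g'(1) g(1) by (rule holomorphic_on_diff)
    qed (use S T that eq_T in auto)
    then have "\<forall>z\<in>C. g' z = g z" using C(2) by auto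
    then have "\<forall>\<^sub>F n in sequentially. \<forall>z\<in>C. dist (f (s (r' n)) z) (g z) < e"
      using g'(4) e(1) unfolding uniform_limit_iff by (force elim: eventually_mono)
    then have "\<forall>\<^sub>F n in sequentially. False"
      by (rule eventually_mono) (use s(2) in blast)
    then show False by simp
  qed
  with g(1) show thesis by (rule that)
qed

section \<open>Truncations of an infinite network\<close>

context infinite_network
begin

lemma edge_in_V: "x \<in> V \<and> y \<in> V" if "{x, y} \<in> E"
  using that edges by (fastforce simp: doubleton_eq_iff)

lemma graph_dist_self: "graph_dist E a a = 0"
  unfolding graph_dist_def by (rule Least_eq_0) simp

lemma graph_dist_edge_le:
  assumes "{x, y} \<in> E"
  shows "graph_dist E a y \<le> Suc (graph_dist E a x)"
proof -
  have "\<exists>n. (a, x) \<in> adj E ^^ n"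
    using connected[OF a_in_V] edge_in_V[OF assms] by (auto simp: rtrancl_power)
  then have "(a, x) \<in> adj E ^^ graph_dist E a x"
    unfolding graph_dist_def by (rule LeastI_ex)
  moreover have "(x, y) \<in> adj E" using assms by (simp add: adj_def)
  ultimately have "(a, y) \<in> adj E ^^ Suc (graph_dist E a x)" by auto
  then show ?thesis unfolding graph_dist_def[of E a y] by (rule Least_le)
qed

abbreviation "Vn \<equiv> graph_ball V E a"
abbreviation "Bn \<equiv> ball_boundary V E a B"
abbreviation "adm \<equiv> admittance E R L D"
abbreviation "Pn \<equiv> partial_admittance V E R L D a B"

lemma admittance_sym: "adm z x y = adm z y x"
  by (simp add: admittance_def insert_commute)

lemma finite_ball: "1 \<le> n \<Longrightarrow> finite (Vn n)"
  and a_in_ball: "a \<in> Vn n"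
  and a_notin_boundary: "1 \<le> n \<Longrightarrow> a \<notin> Bn n"
  using finite_network.finite_V[OF truncation_is_finite_network]
    finite_network.a_notin_B[OF truncation_is_finite_network]
  by (auto simp: graph_ball_def graph_dist_self a_in_V)

lemma ball_mono: "m \<le> n \<Longrightarrow> Vn m \<subseteq> Vn n"
  by (auto simp: graph_ball_def)

lemma admittance_ball_edges:
  "x \<in> Vn n \<Longrightarrow> y \<in> Vn n \<Longrightarrow> admittance (ball_edges V E a n) R L D z x y = adm z x y"
  by (simp add: admittance_def ball_edges_def)

text \<open>
The truncated network may be solved with the weights of the whole network, since these agree with
the truncated ones inside the ball.
\<close>
lemma partial_admittance_eq:
  assumes n: "1 \<le> n" and v: "dirichlet_solution (Vn n) (adm z) a (Bn n) v"
  shows "Pn n z = Some (admittance_of_solution (Vn n) (adm z) a v)"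
proof -
  let ?\<rho> = "admittance (ball_edges V E a n) R L D z"
  have v': "dirichlet_solution (Vn n) ?\<rho> a (Bn n) v"
    using v unfolding dirichlet_solution_def
    by (auto simp: laplacian_def admittance_ball_edges)
  have "Pn n z = Some (admittance_of_solution (Vn n) ?\<rho> a
      (SOME w. dirichlet_solution (Vn n) ?\<rho> a (Bn n) w))"
    using v' by (auto simp: partial_admittance_def effective_admittance_def Let_def)
  also have "admittance_of_solution (Vn n) ?\<rho> a
      (SOME w. dirichlet_solution (Vn n) ?\<rho> a (Bn n) w) =
      admittance_of_solution (Vn n) ?\<rho> a v"
    by (rule admittance_of_solution_unique[OF truncation_is_finite_network[OF n] _ v'])
      (rule someI[of "dirichlet_solution (Vn n) ?\<rho> a (Bn n)", OF v'])
  also have "\<dots> = admittance_of_solution (Vn n) (adm z) a v"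
    unfolding admittance_of_solution_def
    by (intro sum.cong refl) (simp add: admittance_ball_edges a_in_ball)
  finally show ?thesis .
qed

text \<open>
A potential on a ball vanishes on the sphere that bounds it, and interior vertices have all
neighbours inside the ball. Extended by zero it therefore solves a Dirichlet problem on any
larger ball, with the same admittance but a larger zero set. This makes different truncations
comparable on one vertex set.
\<close>
lemma extend_solution_by_zero:
  assumes n: "1 \<le> n" and nm: "n \<le> m"
    and v: "dirichlet_solution (Vn n) (adm z) a (Bn n) v"
  defines "w \<equiv> \<lambda>x. if x \<in> Vn n then v x else 0"
  shows "dirichlet_solution (Vn m) (adm z) a (Bn n \<union> (Vn m - Vn n)) w"
    and "admittance_of_solution (Vn m) (adm z) a w =
      admittance_of_solution (Vn n) (adm z) a v"
proof -
  have lap: "laplacian (Vn m) (adm z) w x = laplacian (Vn n) (adm z) v x"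
    if x: "x \<in> Vn n" "graph_dist E a x < n" for x
  proof -
    have "adm z x y = 0" if "y \<in> Vn m - Vn n" for y
    proof (rule ccontr)
      assume "adm z x y \<noteq> 0"
      then have "{x, y} \<in> E" by (auto simp: admittance_def split: if_splits)
      then have "graph_dist E a y \<le> n" "y \<in> V"
        using graph_dist_edge_le[of x y] edge_in_V[of x y] x by auto
      then show False using that by (simp add: graph_ball_def)
    qed
    then have "laplacian (Vn m) (adm z) w x = laplacian (Vn n) (adm z) w x"
      unfolding laplacian_def using finite_ball n nm ball_mono[OF nm]
      by (intro sum.mono_neutral_right) auto
    also have "\<dots> = laplacian (Vn n) (adm z) v x"
      using x(1) by (intro laplacian_cong) (auto simp: w_def)
    finally show ?thesis .
  qed
  have va: "v a = 1" and vB: "\<And>x. x \<in> Bn n \<Longrightarrow> v x = 0"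
    and vlap: "\<And>x. x \<in> Vn n - (Bn n \<union> {a}) \<Longrightarrow> laplacian (Vn n) (adm z) v x = 0"
    using v by (auto simp: dirichlet_solution_def)
  have wa: "w a = 1" by (simp add: w_def a_in_ball va)
  have "laplacian (Vn m) (adm z) w x = 0"
    if "x \<in> Vn m - (Bn n \<union> (Vn m - Vn n) \<union> {a})" for x
  proof -
    have "x \<in> Vn n - (Bn n \<union> {a})" using that by auto
    moreover from this have "graph_dist E a x < n"
      by (auto simp: ball_boundary_def graph_sphere_def graph_ball_def)
    ultimately show ?thesis using lap[of x] vlap[of x] by auto
  qed
  then show "dirichlet_solution (Vn m) (adm z) a (Bn n \<union> (Vn m - Vn n)) w"
    using wa vB by (auto simp: dirichlet_solution_def w_def)
  have "admittance_of_solution (Vn m) (adm z) a w = - laplacian (Vn m) (adm z) w a"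
    using admittance_sym wa by (intro admittance_eq_laplacian)
  also have "\<dots> = - laplacian (Vn n) (adm z) v a"
    using lap[of a] a_in_ball n by (simp add: graph_dist_self)
  also have "\<dots> = admittance_of_solution (Vn n) (adm z) a v"
    using admittance_sym va by (intro admittance_eq_laplacian[symmetric])
  finally show "admittance_of_solution (Vn m) (adm z) a w =
      admittance_of_solution (Vn n) (adm z) a v" .
qed

end

section \<open>Networks with impedances in a sector\<close>

text \<open>
The hypothesis that all three parts of the theorem have in common: at each \<open>z \<in> S\<close> all edge
impedances lie in one sector around \<open>cnj \<omega>\<close>, of opening less than \<open>\<pi>\<close> and controlled by a continuous
function \<open>\<kappa>\<close>. The bound is uniform over the infinitely many edges, which is what makes the estimates
independent of the truncation.
\<close>
locale sectorial_region = infinite_network +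
  fixes S :: "complex set" and \<omega> :: complex and \<kappa> :: "complex \<Rightarrow> real"
  assumes open_S: "open S" and zero_notin_S: "0 \<notin> S" and unit: "cmod \<omega> = 1"
    and cont_\<kappa>: "continuous_on S \<kappa>"
    and Re_pos: "\<And>z e. z \<in> S \<Longrightarrow> e \<in> E \<Longrightarrow> 0 < Re (\<omega> * impedance R L D z e)"
    and sector: "\<And>z e. z \<in> S \<Longrightarrow> e \<in> E \<Longrightarrow>
      cmod (impedance R L D z e) \<le> \<kappa> z * Re (\<omega> * impedance R L D z e)"
begin

lemma impedance_nonzero: "z \<in> S \<Longrightarrow> e \<in> E \<Longrightarrow> impedance R L D z e \<noteq> 0"
  using Re_pos by force

lemma admissible_ball: "z \<in> S \<Longrightarrow> z \<in> admissible (ball_edges V E a n) R L D"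
proof -
  assume z: "z \<in> S"
  then have "z \<noteq> 0" using zero_notin_S by auto
  moreover have "of_real (L e) * z\<^sup>2 + of_real (R e) * z + of_real (D e) = z * impedance R L D z e" for e
    using \<open>z \<noteq> 0\<close> by (simp add: impedance_def field_simps power2_eq_square)
  ultimately show ?thesis
    using impedance_nonzero[OF z] by (auto simp: admissible_def ball_edges_def)
qed

text \<open>
Inversion reflects the sector of the impedances, which replaces \<open>\<omega>\<close> by \<open>cnj \<omega>\<close>. The maximum with
\<open>1\<close> keeps the constant positive whatever the sign of \<open>\<kappa>\<close>.
\<close>
lemma admittance_sector:
  assumes z: "z \<in> S"
  shows "cmod (adm z x y) \<le> max 1 (\<kappa> z) * Re (cnj \<omega> * adm z x y)"
proof (cases "{x, y} \<in> E")
  case True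
  define Z where "Z = impedance R L D z {x, y}"
  have Z: "0 < cmod Z" "0 < Re (\<omega> * Z)" "cmod Z \<le> \<kappa> z * Re (\<omega> * Z)"
    using impedance_nonzero[OF z True] Re_pos[OF z True] sector[OF z True] by (auto simp: Z_def)
  have "cnj \<omega> * (1 / Z) = cnj (\<omega> * Z) / of_real ((cmod Z)\<^sup>2)"
    using Z(1) unfolding complex_norm_square by (simp add: field_simps)
  then have Re: "Re (cnj \<omega> * (1 / Z)) = Re (\<omega> * Z) / (cmod Z)\<^sup>2"
    by (simp del: of_real_power)
  have "cmod (1 / Z) = cmod Z / (cmod Z)\<^sup>2"
    by (simp add: norm_divide power2_eq_square)
  also have "\<dots> \<le> \<kappa> z * Re (\<omega> * Z) / (cmod Z)\<^sup>2"
    using Z by (intro divide_right_mono) auto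
  also have "\<dots> \<le> max 1 (\<kappa> z) * Re (\<omega> * Z) / (cmod Z)\<^sup>2"
    using Z by (intro divide_right_mono mult_right_mono) auto
  finally show ?thesis using True Re by (simp add: admittance_def Z_def)
qed (simp add: admittance_def)

lemma sectorial_weights_ball:
  assumes z: "z \<in> S" and n: "1 \<le> n"
  shows "sectorial_weights (Vn n) (adm z) (cnj \<omega>) (max 1 (\<kappa> z))"
proof
  fix f :: "'a \<Rightarrow> complex" and x y
  assume f: "\<And>x y. x \<in> Vn n \<Longrightarrow> y \<in> Vn n \<Longrightarrow> adm z x y \<noteq> 0 \<Longrightarrow> f x = f y"
    and xy: "x \<in> Vn n" "y \<in> Vn n"
  interpret fin: finite_network "Vn n" "ball_edges V E a n" R L D a "Bn n"
    by (rule truncation_is_finite_network[OF n])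
  have "(x, y) \<in> (adj (ball_edges V E a n))\<^sup>*" using fin.connected xy .
  then show "f x = f y"
  proof (induction rule: rtrancl_induct)
    case (step u w)
    then have "{u, w} \<in> E" "u \<in> Vn n" "w \<in> Vn n"
      by (auto simp: adj_def ball_edges_def)
    then show ?case
      using step.IH f[of u w] impedance_nonzero[OF z] by (simp add: admittance_def)
  qed simp
qed (use finite_ball[OF n] admittance_sym admittance_sector[OF z] unit in auto)

lemma holomorphic_admittance: "(\<lambda>z. adm z x y) holomorphic_on S"
proof (cases "{x, y} \<in> E")
  case True
  have "(\<lambda>z. 1 / (of_real (R {x, y}) + of_real (L {x, y}) * z + of_real (D {x, y}) / z)) holomorphic_on S"
    using impedance_nonzero[OF _ True] zero_notin_S
    by (intro holomorphic_intros) (auto simp: impedance_def)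
  then show ?thesis using True by (simp add: admittance_def impedance_def)
qed (simp add: admittance_def)

lemma holomorphic_potential:
  assumes n: "1 \<le> n"
  shows "\<exists>v. (\<forall>x. (\<lambda>z. v z x) holomorphic_on S) \<and>
    (\<forall>z\<in>S. dirichlet_solution (Vn n) (adm z) a (Bn n) (v z))"
proof -
  let ?U = "Vn n - (Bn n \<union> {a})"
  have U: "finite ?U" "?U \<subset> Vn n" using finite_ball[OF n] a_in_ball by auto
  obtain v where v: "\<And>x. (\<lambda>z. v z x) holomorphic_on S"
      "\<And>z x. z \<in> S \<Longrightarrow> x \<in> ?U \<Longrightarrow> laplacian (Vn n) (adm z) (v z) x = 0"
      "\<And>z x. x \<notin> ?U \<Longrightarrow> v z x = (if x = a then 1 else 0)"
    using holomorphic_dirichlet_family[OF sectorial_weights_ball[OF _ n] holomorphic_admittance U,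
        of "\<lambda>x. if x = a then 1 else 0"] by blast
  then have "dirichlet_solution (Vn n) (adm z) a (Bn n) (v z)" if "z \<in> S" for z
    using that a_notin_boundary[OF n] by (auto simp: dirichlet_solution_def)
  with v(1) show ?thesis by (intro exI[of _ v]) auto
qed

lemma ex_dirichlet_solution:
  "1 \<le> n \<Longrightarrow> z \<in> S \<Longrightarrow> \<exists>v. dirichlet_solution (Vn n) (adm z) a (Bn n) v"
  using holomorphic_potential by blast

lemma partial_admittance_not_None: "1 \<le> n \<Longrightarrow> z \<in> S \<Longrightarrow> Pn n z \<noteq> None"
  using ex_dirichlet_solution[of n z] by (auto simp: partial_admittance_eq)

lemma holomorphic_partial_admittance:
  assumes n: "1 \<le> n"
  shows "(\<lambda>z. the (Pn n z)) holomorphic_on S"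
proof -
  obtain v where v: "\<And>x. (\<lambda>z. v z x) holomorphic_on S"
      "\<And>z. z \<in> S \<Longrightarrow> dirichlet_solution (Vn n) (adm z) a (Bn n) (v z)"
    using holomorphic_potential[OF n] by blast
  have "(\<lambda>z. admittance_of_solution (Vn n) (adm z) a (v z)) holomorphic_on S"
    unfolding admittance_of_solution_def
    by (intro holomorphic_intros holomorphic_admittance v(1))
  then show ?thesis
    by (rule holomorphic_transform) (simp add: partial_admittance_eq[OF n v(2)])
qed

lemma locally_bounded_partial_admittance:
  assumes C: "compact C" "C \<subseteq> S"
  shows "\<exists>M. \<forall>n\<ge>1. \<forall>z\<in>C. cmod (the (Pn n z)) \<le> M"
proof -
  let ?N = "{y. {a, y} \<in> E}"
  have N: "finite ?N" by (rule locally_finite[OF a_in_V])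
  define b where "b z = 2 * max 1 (\<kappa> z) * (\<Sum>x\<in>?N. cmod (adm z x a))" for z
  have "continuous_on S b"
    unfolding b_def[abs_def]
    by (intro continuous_intros cont_\<kappa> holomorphic_on_imp_continuous_on holomorphic_admittance)
  then have "compact (b ` C)"
    using C continuous_on_subset compact_continuous_image by blast
  then obtain M where M: "\<forall>z\<in>C. \<bar>b z\<bar> \<le> M"
    by (auto dest!: compact_imp_bounded simp: bounded_iff)
  have "cmod (the (Pn n z)) \<le> M" if n: "1 \<le> n" and z: "z \<in> C" for n z
  proof -
    have zS: "z \<in> S" using C z by auto
    obtain v where v: "dirichlet_solution (Vn n) (adm z) a (Bn n) v"
      using ex_dirichlet_solution[OF n zS] by blast
    have "cmod (the (Pn n z)) \<le> 2 * max 1 (\<kappa> z) * (\<Sum>x\<in>Vn n. cmod (adm z x a))"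
      using sectorial_weights.admittance_bound[OF sectorial_weights_ball[OF zS n] v a_in_ball]
      by (simp add: partial_admittance_eq[OF n v])
    also have "(\<Sum>x\<in>Vn n. cmod (adm z x a)) = (\<Sum>x\<in>Vn n \<inter> ?N. cmod (adm z x a))"
      using finite_ball[OF n]
      by (intro sum.mono_neutral_right) (auto simp: admittance_def insert_commute)
    finally have "cmod (the (Pn n z)) \<le> 2 * max 1 (\<kappa> z) * (\<Sum>x\<in>Vn n \<inter> ?N. cmod (adm z x a))" .
    also have "\<dots> \<le> b z"
      unfolding b_def using N by (intro mult_left_mono sum_mono2) auto
    finally have "cmod (the (Pn n z)) \<le> b z" .
    then show ?thesis using bspec[OF M z] by linarith
  qed
  then show ?thesis by blast
qed

text \<open>
Local boundedness holds on all of \<open>S\<close>, so convergence needs to be checked only on a set with an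
accumulation point.
\<close>
lemma converge_from_accumulating_set:
  assumes S: "connected S" and T: "T \<subseteq> S" "\<xi> \<in> S" "\<xi> islimpt T"
    and conv: "\<And>z. z \<in> T \<Longrightarrow> convergent (\<lambda>n. the (Pn n z))"
  shows "admittances_converge_locally_uniformly_on S V E R L D a B"
    and "limit_admittance V E R L D a B holomorphic_on S"
proof -
  \<comment> \<open>the truncations start at radius \<open>1\<close>, whence the shift of the index\<close>
  obtain g where g: "g holomorphic_on S"
    and lim: "\<And>C. compact C \<Longrightarrow> C \<subseteq> S \<Longrightarrow>
      uniform_limit C (\<lambda>n z. the (Pn (Suc n) z)) g sequentially"
  proof (rule vitali_convergence[OF open_S S _ _ T, of "\<lambda>n z. the (Pn (Suc n) z)"])
    show "(\<lambda>z. the (Pn (Suc n) z)) holomorphic_on S" for n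
      by (rule holomorphic_partial_admittance) simp
    show "\<exists>M. \<forall>n. \<forall>z\<in>C. cmod (the (Pn (Suc n) z)) \<le> M" if "compact C" "C \<subseteq> S" for C
      using locally_bounded_partial_admittance[OF that] by auto
    show "convergent (\<lambda>n. the (Pn (Suc n) z))" if "z \<in> T" for z
      using conv[OF that] convergent_Suc_iff[of "\<lambda>n. the (Pn n z)"] by simp
  qed blast
  have lim': "uniform_limit C (\<lambda>n z. the (Pn n z)) g sequentially" if "compact C" "C \<subseteq> S" for C
    using lim[OF that] eventually_sequentially_Suc unfolding uniform_limit_iff by blast
  have eq: "limit_admittance V E R L D a B z = g z" if "z \<in> S" for z
  proof -
    have "(\<lambda>n. the (Pn n z)) \<longlonglongrightarrow> g z"
      using lim'[of "{z}"] that by (auto intro: tendsto_uniform_limitI)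
    then show ?thesis unfolding limit_admittance_def by (rule limI)
  qed
  show "limit_admittance V E R L D a B holomorphic_on S"
    using g by (rule holomorphic_transform) (simp add: eq)
  have "\<exists>r>0. cball z r \<subseteq> S \<and> uniform_limit (cball z r) (\<lambda>n w. the (Pn n w))
      (limit_admittance V E R L D a B) sequentially" if z: "z \<in> S" for z
  proof -
    obtain r where r: "r > 0" "cball z r \<subseteq> S"
      using open_contains_cball_eq[OF open_S] z by blast
    have "uniform_limit (cball z r) (\<lambda>n w. the (Pn n w)) (limit_admittance V E R L D a B) sequentially
        \<longleftrightarrow> uniform_limit (cball z r) (\<lambda>n w. the (Pn n w)) g sequentially"
      by (rule uniform_limit_cong') (use r eq in auto)
    with r lim'[OF compact_cball r(2)] show ?thesis by (intro exI[of _ r]) simp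
  qed
  then show "admittances_converge_locally_uniformly_on S V E R L D a B"
    unfolding admittances_converge_locally_uniformly_on_def
    using admissible_ball partial_admittance_not_None by simp
qed

end

section \<open>The right half plane\<close>

context infinite_network
begin

text \<open>
Both \<open>z\<close> and \<open>1 / z\<close> have real part \<open>Re z / cmod z\<close> times their modulus, and that ratio is at
most \<open>1\<close>; a nonnegative combination of \<open>1\<close>, \<open>z\<close> and \<open>1 / z\<close> then lies in the sector
that \<open>z\<close> and \<open>cnj z\<close> span.
\<close>
lemma sectorial_right_half_plane:
  "sectorial_region V E R L D a B {z. 0 < Re z} 1 (\<lambda>z. cmod z / Re z)"
proof
  show "open {z. 0 < Re z}" by (rule open_halfspace_Re_gt)
  show "continuous_on {z. 0 < Re z} (\<lambda>z. cmod z / Re z)"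
    by (intro continuous_intros) auto
  fix z :: complex and e assume z: "z \<in> {z. 0 < Re z}" and e: "e \<in> E"
  let ?Z = "impedance R L D z e"
  define r where "r = cmod z"
  define q where "q = Re z / r"
  have r: "0 < r" using z by (auto simp: r_def)
  have q: "0 < q" "q \<le> 1" using z r complex_Re_le_cmod[of z] by (auto simp: q_def r_def)
  have n: "0 \<le> R e" "0 \<le> L e" "0 \<le> D e" using nonneg[OF e] by auto
  define z' where "z' = inverse z"
  have "Re z' = Re z / (cmod z)\<^sup>2" by (simp add: z'_def cmod_power2)
  then have "Re z' = q / r" by (simp add: q_def r_def power2_eq_square)
  moreover have "Re z = q * r" using r by (simp add: q_def)
  moreover have "?Z = of_real (R e) + of_real (L e) * z + of_real (D e) * z'"
    by (simp add: impedance_def divide_inverse z'_def)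
  ultimately have Re: "Re ?Z = R e + q * (L e * r + D e / r)"
    by (simp add: algebra_simps)
  have "cmod ?Z \<le> R e + L e * r + D e / r"
    unfolding impedance_def r_def using n
    by (intro norm_triangle_le add_mono) (auto simp: norm_mult norm_divide)
  moreover have Re_ge: "q * (R e + L e * r + D e / r) \<le> Re ?Z"
    using q n mult_right_mono[of q 1 "R e"] by (simp add: Re algebra_simps)
  ultimately have "q * cmod ?Z \<le> Re ?Z"
    using q(1) by (meson less_imp_le mult_left_mono order_trans)
  then show "cmod ?Z \<le> cmod z / Re z * Re (1 * ?Z)"
    using q(1) r z by (simp add: q_def r_def field_simps)
  have "0 < R e + L e * r + D e / r"
  proof (rule ccontr)
    assume "\<not> 0 < R e + L e * r + D e / r"
    moreover have "0 \<le> L e * r" "0 \<le> D e / r" using n r by auto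
    ultimately have "R e = 0" "L e * r = 0" "D e / r = 0" using n by linarith+
    then show False using r nonzero[OF e] by simp
  qed
  then show "0 < Re (1 * ?Z)" using Re_ge q(1) by (smt (verit) mult_pos_pos mult_1)
qed auto

text \<open>
At a positive frequency all weights are positive. Comparing successive truncations on the larger ball
shows that the admittances decrease with the radius, and they are nonnegative.
\<close>
lemma convergent_at_positive_real:
  assumes t: "0 < t"
  shows "convergent (\<lambda>n. the (Pn n (of_real t)))"
proof -
  interpret sectorial_region V E R L D a B "{z. 0 < Re z}" 1 "\<lambda>z. cmod z / Re z"
    by (rule sectorial_right_half_plane)
  define c where "c x y = (if {x, y} \<in> E then 1 / (R {x, y} + L {x, y} * t + D {x, y} / t) else 0)"
    for x y
  have adm: "adm (of_real t) = (\<lambda>x y. of_real (c x y))"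
    by (intro ext) (simp add: admittance_def impedance_def c_def)
  have c_sym: "c x y = c y x" and c_nonneg: "0 \<le> c x y" for x y
    using nonneg t by (auto simp: c_def insert_commute)
  have sol: "\<exists>v. dirichlet_solution (Vn n) (adm (of_real t)) a (Bn n) v" if "1 \<le> n" for n
    using ex_dirichlet_solution[OF that, of "of_real t"] t by simp
  define p where "p n = the (Pn (Suc n) (of_real t))" for n
  have p: "p n \<in> \<real> \<and> 0 \<le> Re (p n) \<and> Re (p (Suc n)) \<le> Re (p n)" for n
  proof -
    let ?W = "Vn (Suc (Suc n))"
    obtain v where v: "dirichlet_solution (Vn (Suc n)) (adm (of_real t)) a (Bn (Suc n)) v"
      using sol[of "Suc n"] by auto
    obtain v' where v': "dirichlet_solution ?W (adm (of_real t)) a (Bn (Suc (Suc n))) v'"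
      using sol[of "Suc (Suc n)"] by auto
    define w where "w x = (if x \<in> Vn (Suc n) then v x else 0)" for x
    have w: "dirichlet_solution ?W (adm (of_real t)) a (Bn (Suc n) \<union> (?W - Vn (Suc n))) w"
      "admittance_of_solution ?W (adm (of_real t)) a w = p n"
      using extend_solution_by_zero[OF _ _ v, of "Suc (Suc n)"] partial_admittance_eq[OF _ v]
      by (auto simp: w_def[abs_def] p_def)
    have p': "admittance_of_solution ?W (adm (of_real t)) a v' = p (Suc n)"
      using partial_admittance_eq[OF _ v'] by (simp add: p_def)
    have Z: "Bn (Suc (Suc n)) \<subseteq> Bn (Suc n) \<union> (?W - Vn (Suc n))"
      by (auto simp: ball_boundary_def graph_ball_def graph_sphere_def)
    have fin: "finite ?W" by (rule finite_ball) simp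
    note mono = real_admittance_antimono[where c = c, OF fin c_sym c_nonneg a_in_ball, folded adm]
    show ?thesis
      using mono(1,2)[OF w(1) w(1)] mono(3)[OF v' w(1) Z] w(2) p' by auto
  qed
  then have "decseq (\<lambda>n. Re (p n))" by (intro decseq_SucI) blast
  then obtain l where "(\<lambda>n. Re (p n)) \<longlonglongrightarrow> l"
    using decseq_convergent[of "\<lambda>n. Re (p n)" 0] p by blast
  then have "(\<lambda>n. of_real (Re (p n))) \<longlonglongrightarrow> complex_of_real l"
    by (rule tendsto_of_real)
  moreover have "of_real (Re (p n)) = p n" for n
    using p[of n] by (simp add: of_real_Re)
  ultimately have "convergent p" by (auto simp: convergent_def)
  then show ?thesis
    using convergent_Suc_iff[of "\<lambda>n. the (Pn n (of_real t))"] by (simp add: p_def[abs_def])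
qed

lemma converge_right_half_plane:
  "admittances_converge_locally_uniformly_on {z. 0 < Re z} V E R L D a B"
  "limit_admittance V E R L D a B holomorphic_on {z. 0 < Re z}"
proof -
  interpret sectorial_region V E R L D a B "{z. 0 < Re z}" 1 "\<lambda>z. cmod z / Re z"
    by (rule sectorial_right_half_plane)
  let ?T = "complex_of_real ` {0<..}"
  have conn: "connected {z. 0 < Re z}"
    by (intro convex_connected convex_halfspace_Re_gt)
  have T: "?T \<subseteq> {z. 0 < Re z}" "1 \<in> {z. 0 < Re z}" by auto
  have lim: "1 islimpt ?T"
    unfolding islimpt_approachable
  proof (intro allI impI)
    fix e :: real assume "0 < e"
    moreover have "dist (of_real (1 + e / 2)) (1 :: complex) = \<bar>e / 2\<bar>"
    proof -
      have "of_real (1 + e / 2) - 1 = complex_of_real (e / 2)" by simp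
      then show ?thesis by (simp only: dist_norm norm_of_real)
    qed
    moreover have "complex_of_real (1 + e / 2) \<noteq> 1"
      using \<open>0 < e\<close> by (simp only: of_real_eq_1_iff)
    ultimately show "\<exists>x\<in>?T. x \<noteq> 1 \<and> dist x 1 < e"
      by (intro bexI[of _ "of_real (1 + e / 2)"] imageI) (simp_all del: of_real_add)
  qed
  have conv: "convergent (\<lambda>n. the (Pn n z))" if "z \<in> ?T" for z
    using that convergent_at_positive_real by auto
  show "admittances_converge_locally_uniformly_on {z. 0 < Re z} V E R L D a B"
    "limit_admittance V E R L D a B holomorphic_on {z. 0 < Re z}"
    using converge_from_accumulating_set[OF conn T lim conv] by auto
qed

end

section \<open>Regions away from the real axis\<close>

text \<open>
The regions of parts (b) and (c) of the theorem each have two components, \<open>\<sigma> = 1\<close> for the upper and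
\<open>\<sigma> = -1\<close> for the lower half plane. The sign \<open>\<tau>\<close> selects the outside (\<open>\<tau> = 1\<close>) or the inside
(\<open>\<tau> = -1\<close>) of the circle \<open>(cmod z)\<^sup>2 = s\<close>, so that one argument serves for both parts.
\<close>
definition half_region :: "real \<Rightarrow> real \<Rightarrow> real \<Rightarrow> complex set" where
  "half_region \<sigma> \<tau> s = {z. 0 < \<sigma> * Im z \<and> \<tau> * s < \<tau> * (cmod z)\<^sup>2}"

lemma open_half_region: "open (half_region \<sigma> \<tau> s)"
  unfolding half_region_def by (intro open_Collect_conj open_Collect_less continuous_intros)

lemma convex_half_disc: "convex {w. 0 < \<sigma> * Im w \<and> s * (cmod w)\<^sup>2 < 1}"
proof -
  have half: "convex {w. 0 < \<sigma> * Im w}"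
  proof -
    have "{w. 0 < \<sigma> * Im w} = {w. inner (complex_of_real \<sigma> * \<i>) w > 0}"
      by (simp add: inner_complex_def)
    then show ?thesis by (simp add: convex_halfspace_gt)
  qed
  have disc: "convex {w :: complex. s * (cmod w)\<^sup>2 < 1}"
  proof (cases "s \<le> 0")
    case True
    then have "s * (cmod w)\<^sup>2 \<le> 0" for w by (intro mult_nonpos_nonneg) auto
    then have "{w :: complex. s * (cmod w)\<^sup>2 < 1} = UNIV"
      by (force intro: order_le_less_trans)
    then show ?thesis by simp
  next
    case False
    have eq: "s * (cmod w)\<^sup>2 < 1 \<longleftrightarrow> cmod w < 1 / sqrt s" for w
    proof -
      have "s * (cmod w)\<^sup>2 < 1 \<longleftrightarrow> (cmod w)\<^sup>2 < (1 / sqrt s)\<^sup>2"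
        using False by (simp add: power_divide field_simps)
      also have "\<dots> \<longleftrightarrow> cmod w < 1 / sqrt s"
        using False power2_less_imp_less[of "cmod w" "1 / sqrt s"]
          power_strict_mono[of "cmod w" "1 / sqrt s" 2] by auto
      finally show ?thesis .
    qed
    show ?thesis unfolding eq using convex_ball[of "0 :: complex" "1 / sqrt s"] by (simp add: ball_def)
  qed
  show ?thesis using convex_Int[OF half disc] by (simp add: Int_def)
qed

lemma connected_half_region_inside:
  assumes "0 < s"
  shows "connected (half_region \<sigma> (-1) s)"
proof -
  have "half_region \<sigma> (-1) s = {w. 0 < \<sigma> * Im w \<and> 1 / s * (cmod w)\<^sup>2 < 1}"
    using assms by (auto simp: half_region_def field_simps)
  then show ?thesis using convex_half_disc[of \<sigma> "1 / s"] convex_connected by simp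
qed

text \<open>
The map \<open>w \<mapsto> - 1 / w\<close> preserves the half planes and exchanges the inside and the outside of circles
around \<open>0\<close>; it carries a convex set onto the region.
\<close>
lemma connected_half_region_outside: "connected (half_region \<sigma> 1 s)"
proof -
  let ?H = "{w. 0 < \<sigma> * Im w \<and> s * (cmod w)\<^sup>2 < 1}"
  have Im: "\<sigma> * Im (- 1 / w) = \<sigma> * Im w / (cmod w)\<^sup>2" for w
    by (simp add: Im_divide cmod_power2)
  have nz: "w \<noteq> 0" if "0 < \<sigma> * Im w" for w using that by auto
  have "half_region \<sigma> 1 s = (\<lambda>w. - 1 / w) ` ?H"
  proof (intro set_eqI iffI)
    fix z assume z: "z \<in> half_region \<sigma> 1 s"
    then have "z \<noteq> 0" using nz[of z] by (auto simp: half_region_def)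
    then have "- 1 / z \<in> ?H"
      using z unfolding mem_Collect_eq Im
      by (simp add: half_region_def norm_divide power_divide field_simps)
    then show "z \<in> (\<lambda>w. - 1 / w) ` ?H"
      using \<open>z \<noteq> 0\<close> by (intro image_eqI[of _ _ "- 1 / z"]) auto
  next
    fix z assume "z \<in> (\<lambda>w. - 1 / w) ` ?H"
    then obtain w where w: "z = - 1 / w" "0 < \<sigma> * Im w" "s * (cmod w)\<^sup>2 < 1" by auto
    then have "w \<noteq> 0" using nz by auto
    then show "z \<in> half_region \<sigma> 1 s"
      using w(2,3) unfolding half_region_def mem_Collect_eq w(1) Im
      by (simp add: norm_divide power_divide field_simps)
  qed
  moreover have "connected ((\<lambda>w. - 1 / w) ` ?H)"
    using nz
    by (intro connected_continuous_image continuous_intros convex_connected convex_half_disc) auto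
  ultimately show ?thesis by simp
qed

lemma half_region_meets_right_half_plane:
  assumes "\<sigma> \<in> {1, -1}" "\<tau> = 1 \<or> \<tau> = -1 \<and> 0 < s"
  shows "half_region \<sigma> \<tau> s \<inter> {z. 0 < Re z} \<noteq> {}"
proof -
  have mem: "Complex r (\<sigma> * r) \<in> half_region \<sigma> \<tau> s \<inter> {z. 0 < Re z}"
    if "0 < r" "\<tau> * s < \<tau> * (2 * r\<^sup>2)" for r
  proof -
    have "(cmod (Complex r (\<sigma> * r)))\<^sup>2 = 2 * r\<^sup>2"
      using assms(1) by (auto simp: cmod_power2)
    then show ?thesis using that assms(1) by (auto simp: half_region_def)
  qed
  show ?thesis
  proof (cases "\<tau> = 1")
    case True
    have "s < 2 * (1 + \<bar>s\<bar>)\<^sup>2"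
      by (simp add: power2_eq_square algebra_simps)
        (use abs_ge_self[of s] in \<open>smt (verit) zero_le_mult_iff\<close>)
    then show ?thesis using mem[of "1 + \<bar>s\<bar>"] True by force
  next
    case False
    then have "\<tau> = -1" "0 < s" using assms(2) by auto
    then show ?thesis using mem[of "sqrt (s / 4)"] by force
  qed
qed

context infinite_network
begin

text \<open>
The imaginary part of \<open>R + L * z + D / z\<close> is \<open>Im z * (L - D / (cmod z)\<^sup>2)\<close>, and its sign is the same
for all edges once \<open>(cmod z)\<^sup>2\<close> is beyond all the ratios \<open>D / L\<close> on one side. Its size is then comparable
to \<open>L\<close>, and by the bounds on \<open>R / L\<close> and \<open>D / L\<close> so is the modulus of the impedance.
\<close>
lemma sectorial_half_region:
  assumes \<sigma>: "\<sigma> \<in> {1, -1}" and \<tau>: "\<tau> \<in> {1, -1}"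
    and L_pos: "\<And>e. e \<in> E \<Longrightarrow> 0 < L e"
    and R_le: "\<And>e. e \<in> E \<Longrightarrow> R e / L e \<le> sR" and D_le: "\<And>e. e \<in> E \<Longrightarrow> D e / L e \<le> sD"
    and D_s: "\<And>e. e \<in> E \<Longrightarrow> \<tau> * (D e / L e) \<le> \<tau> * s"
  shows "sectorial_region V E R L D a B (half_region \<sigma> \<tau> s) (- of_real (\<sigma> * \<tau>) * \<i>)
    (\<lambda>z. (sR + cmod z + sD / cmod z) / (\<sigma> * Im z * (\<tau> * (1 - s / (cmod z)\<^sup>2))))"
proof
  have nz: "z \<noteq> 0" "0 < \<sigma> * Im z" "0 < \<tau> * (1 - s / (cmod z)\<^sup>2)" if "z \<in> half_region \<sigma> \<tau> s" for z
  proof -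
    show *: "0 < \<sigma> * Im z" "z \<noteq> 0" using that by (auto simp: half_region_def)
    have "0 < (\<tau> * (cmod z)\<^sup>2 - \<tau> * s) / (cmod z)\<^sup>2"
      using that *(2) by (intro divide_pos_pos) (auto simp: half_region_def)
    also have "\<dots> = \<tau> * (1 - s / (cmod z)\<^sup>2)"
      using *(2) by (simp add: field_simps)
    finally show "0 < \<tau> * (1 - s / (cmod z)\<^sup>2)" .
  qed
  show "open (half_region \<sigma> \<tau> s)" by (rule open_half_region)
  show "0 \<notin> half_region \<sigma> \<tau> s" by (simp add: half_region_def)
  show "cmod (- of_real (\<sigma> * \<tau>) * \<i>) = 1" using \<sigma> \<tau> by (auto simp: norm_mult)
  have "\<sigma> * Im z * (\<tau> * (1 - s / (cmod z)\<^sup>2)) \<noteq> 0" if "z \<in> half_region \<sigma> \<tau> s" for z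
    using mult_pos_pos[OF nz(2,3)[OF that]] by (metis less_irrefl)
  then show "continuous_on (half_region \<sigma> \<tau> s)
      (\<lambda>z. (sR + cmod z + sD / cmod z) / (\<sigma> * Im z * (\<tau> * (1 - s / (cmod z)\<^sup>2))))"
    using nz(1) by (intro continuous_intros ballI) (simp_all)
  fix z e assume z: "z \<in> half_region \<sigma> \<tau> s" and e: "e \<in> E"
  let ?Z = "impedance R L D z e"
  define r where "r = cmod z"
  have r: "0 < r" using nz(1)[OF z] by (simp add: r_def)
  define q where "q = \<sigma> * Im z * (\<tau> * (1 - s / r\<^sup>2))"
  have q: "0 < q" using mult_pos_pos[OF nz(2,3)[OF z]] by (simp add: q_def r_def)
  have l: "0 < L e" using L_pos[OF e] .
  have n: "0 \<le> R e" "0 \<le> D e" using nonneg[OF e] by auto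
  have "Im ?Z = Im z * (L e - D e / r\<^sup>2)"
    by (simp add: impedance_def Im_divide r_def cmod_power2 algebra_simps)
  then have Re: "Re (- of_real (\<sigma> * \<tau>) * \<i> * ?Z) = \<sigma> * Im z * (\<tau> * (L e - D e / r\<^sup>2))"
    by (simp add: mult_ac)
  have "L e * (\<tau> * (1 - s / r\<^sup>2)) \<le> \<tau> * (L e - D e / r\<^sup>2)"
  proof -
    define d where "d = D e / L e"
    have D_eq: "D e = L e * d" using l by (simp add: d_def)
    have "L e * (\<tau> * d) / r\<^sup>2 \<le> L e * (\<tau> * s) / r\<^sup>2"
      by (rule divide_right_mono[OF mult_left_mono]) (use D_s[OF e] l in \<open>auto simp: d_def\<close>)
    then show ?thesis by (simp add: D_eq algebra_simps)
  qed
  then have "\<sigma> * Im z * (L e * (\<tau> * (1 - s / r\<^sup>2))) \<le> \<sigma> * Im z * (\<tau> * (L e - D e / r\<^sup>2))"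
    using nz(2)[OF z] by (intro mult_left_mono) auto
  then have Re_ge: "L e * q \<le> Re (- of_real (\<sigma> * \<tau>) * \<i> * ?Z)"
    unfolding Re by (simp add: q_def mult_ac)
  moreover have "0 < L e * q" using l q by simp
  ultimately show "0 < Re (- of_real (\<sigma> * \<tau>) * \<i> * ?Z)" by linarith
  have "cmod ?Z \<le> R e + L e * r + D e / r"
    unfolding impedance_def r_def using n l
    by (intro norm_triangle_le add_mono) (auto simp: norm_mult norm_divide)
  also have "\<dots> \<le> L e * sR + L e * r + L e * sD / r"
  proof -
    have "R e \<le> L e * sR" "D e \<le> L e * sD"
      using R_le[OF e] D_le[OF e] l by (simp_all add: field_simps)
    then show ?thesis using r by (intro add_mono divide_right_mono) auto
  qed
  also have "\<dots> = (sR + r + sD / r) * L e"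
    by (simp add: algebra_simps)
  also have "\<dots> = (sR + r + sD / r) / q * (L e * q)"
    using q by simp
  also have "\<dots> \<le> (sR + r + sD / r) / q * Re (- of_real (\<sigma> * \<tau>) * \<i> * ?Z)"
  proof -
    have "0 \<le> R e / L e" "0 \<le> D e / L e" using n l by auto
    then have "0 \<le> sR" "0 \<le> sD" using R_le[OF e] D_le[OF e] by linarith+
    then show ?thesis using q r Re_ge by (intro mult_left_mono) auto
  qed
  finally show "cmod ?Z \<le> (sR + cmod z + sD / cmod z) / (\<sigma> * Im z * (\<tau> * (1 - s / (cmod z)\<^sup>2))) *
      Re (- of_real (\<sigma> * \<tau>) * \<i> * ?Z)"
    by (simp only: q_def r_def)
qed

text \<open>
The half region meets the right half plane, where convergence is already known, in a nonempty open
set; from there it spreads over the whole connected region.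
\<close>
lemma converge_half_region:
  assumes \<sigma>: "\<sigma> \<in> {1, -1}" and \<tau>: "\<tau> = 1 \<or> \<tau> = -1 \<and> 0 < s"
    and bounds: "\<And>e. e \<in> E \<Longrightarrow> 0 < L e" "\<And>e. e \<in> E \<Longrightarrow> R e / L e \<le> sR"
      "\<And>e. e \<in> E \<Longrightarrow> D e / L e \<le> sD" "\<And>e. e \<in> E \<Longrightarrow> \<tau> * (D e / L e) \<le> \<tau> * s"
  shows "admittances_converge_locally_uniformly_on (half_region \<sigma> \<tau> s) V E R L D a B"
    and "limit_admittance V E R L D a B holomorphic_on (half_region \<sigma> \<tau> s)"
proof -
  let ?S = "half_region \<sigma> \<tau> s"
  let ?T = "?S \<inter> {z. 0 < Re z}"
  have "\<tau> \<in> {1, -1}" using \<tau> by auto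
  then interpret sectorial_region V E R L D a B ?S "- of_real (\<sigma> * \<tau>) * \<i>"
      "\<lambda>z. (sR + cmod z + sD / cmod z) / (\<sigma> * Im z * (\<tau> * (1 - s / (cmod z)\<^sup>2)))"
    using sectorial_half_region[OF \<sigma> _ bounds] by simp
  have conn: "connected ?S"
    using \<tau> connected_half_region_inside connected_half_region_outside by auto
  have "open ?T" by (intro open_Int open_half_region open_halfspace_Re_gt)
  obtain \<xi> where \<xi>: "\<xi> \<in> ?T" using half_region_meets_right_half_plane[OF \<sigma> \<tau>] by blast
  have lim: "\<xi> islimpt ?T"
    using \<xi> interior_open[OF \<open>open ?T\<close>] by (intro interior_limit_point) (simp only:)
  have conv: "convergent (\<lambda>n. the (Pn n z))" if z: "z \<in> ?T" for z
  proof -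
    obtain r where "r > 0" "uniform_limit (cball z r) (\<lambda>n w. the (Pn n w))
        (limit_admittance V E R L D a B) sequentially"
      using converge_right_half_plane(1) z
      unfolding admittances_converge_locally_uniformly_on_def by blast
    then have "(\<lambda>n. the (Pn n z)) \<longlonglongrightarrow> limit_admittance V E R L D a B z"
      by (elim tendsto_uniform_limitI) simp
    then show ?thesis by (rule convergentI)
  qed
  have T: "?T \<subseteq> ?S" "\<xi> \<in> ?S" using \<xi> by auto
  show "admittances_converge_locally_uniformly_on ?S V E R L D a B"
    "limit_admittance V E R L D a B holomorphic_on ?S"
    using converge_from_accumulating_set[OF conn T lim conv] by auto
qed

lemma converge_both_half_regions:
  assumes \<tau>: "\<tau> = 1 \<or> \<tau> = -1 \<and> 0 < s"
    and bounds: "\<And>e. e \<in> E \<Longrightarrow> 0 < L e" "\<And>e. e \<in> E \<Longrightarrow> R e / L e \<le> sR"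
      "\<And>e. e \<in> E \<Longrightarrow> D e / L e \<le> sD" "\<And>e. e \<in> E \<Longrightarrow> \<tau> * (D e / L e) \<le> \<tau> * s"
  defines "\<Omega> \<equiv> {z. Im z \<noteq> 0 \<and> \<tau> * s < \<tau> * (cmod z)\<^sup>2}"
  shows "admittances_converge_locally_uniformly_on \<Omega> V E R L D a B"
    and "limit_admittance V E R L D a B holomorphic_on \<Omega>"
proof -
  let ?S = "\<lambda>\<sigma>. half_region \<sigma> \<tau> s"
  have \<Omega>: "\<Omega> = ?S 1 \<union> ?S (-1)"
    by (auto simp: \<Omega>_def half_region_def)
  have conv: "admittances_converge_locally_uniformly_on (?S \<sigma>) V E R L D a B"
      "limit_admittance V E R L D a B holomorphic_on ?S \<sigma>" if "\<sigma> \<in> {1, -1}" for \<sigma>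
    using converge_half_region[OF that \<tau> bounds] by auto
  show "limit_admittance V E R L D a B holomorphic_on \<Omega>"
    using conv(2)[of 1] conv(2)[of "-1"] open_half_region
    by (simp add: \<Omega> open_Un analytic_on_Un flip: analytic_on_open)
  have "admittances_converge_locally_uniformly_on (A \<union> A') V E R L D a B"
    if "admittances_converge_locally_uniformly_on A V E R L D a B"
      "admittances_converge_locally_uniformly_on A' V E R L D a B" for A A'
    using that unfolding admittances_converge_locally_uniformly_on_def
    by (metis Un_iff le_supI1 le_supI2)
  then show "admittances_converge_locally_uniformly_on \<Omega> V E R L D a B"
    unfolding \<Omega> using conv(1) by simp
qed

end

section \<open>Convergence of the effective admittances\<close>

theorem theorem22:
  fixes V :: "'a set" and E :: "'a set set" and R L D :: "'a set \<Rightarrow> real"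
    and a :: 'a and B :: "'a set"
  assumes "infinite_network V E R L D a B"
  shows
   "(let \<Omega> = {z :: complex. Re z > 0} in
      admittances_converge_locally_uniformly_on \<Omega> V E R L D a B \<and>
      limit_admittance V E R L D a B holomorphic_on \<Omega>) \<and>
    ((\<forall>e\<in>E. L e > 0) \<and> bdd_above ((\<lambda>e. D e / L e) ` E) \<and> bdd_above ((\<lambda>e. R e / L e) ` E) \<longrightarrow>
      (let \<Omega> = {z :: complex. Im z \<noteq> 0 \<and> (cmod z)\<^sup>2 > (SUP e\<in>E. D e / L e)} in
        admittances_converge_locally_uniformly_on \<Omega> V E R L D a B \<and>
        limit_admittance V E R L D a B holomorphic_on \<Omega>)) \<and>
    ((\<forall>e\<in>E. L e > 0) \<and> bdd_above ((\<lambda>e. D e / L e) ` E) \<and> bdd_above ((\<lambda>e. R e / L e) ` E) \<and>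
      (INF e\<in>E. D e / L e) > 0 \<longrightarrow>
      (let \<Omega> = {z :: complex. Im z \<noteq> 0 \<and> (cmod z)\<^sup>2 < (INF e\<in>E. D e / L e)} in
        admittances_converge_locally_uniformly_on \<Omega> V E R L D a B \<and>
        limit_admittance V E R L D a B holomorphic_on \<Omega>))"
proof -
  interpret infinite_network V E R L D a B by (fact assms)
  let ?SD = "SUP e\<in>E. D e / L e" and ?SR = "SUP e\<in>E. R e / L e" and ?ID = "INF e\<in>E. D e / L e"
  have bounds: "0 < L e" "R e / L e \<le> ?SR" "D e / L e \<le> ?SD" "?ID \<le> D e / L e"
    if "(\<forall>e\<in>E. L e > 0) \<and> bdd_above ((\<lambda>e. D e / L e) ` E) \<and> bdd_above ((\<lambda>e. R e / L e) ` E)"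
      and e: "e \<in> E" for e
  proof -
    have "bdd_below ((\<lambda>e. D e / L e) ` E)"
      using that nonneg by (intro bdd_belowI[of _ 0]) auto
    then show "0 < L e" "R e / L e \<le> ?SR" "D e / L e \<le> ?SD" "?ID \<le> D e / L e"
      using that by (auto intro: cSUP_upper cINF_lower)
  qed
  show ?thesis
    unfolding Let_def
  proof (intro conjI impI; (elim conjE)?)
    show "admittances_converge_locally_uniformly_on {z. 0 < Re z} V E R L D a B"
      "limit_admittance V E R L D a B holomorphic_on {z. 0 < Re z}"
      by (rule converge_right_half_plane)+
  next
    assume "\<forall>e\<in>E. L e > 0" "bdd_above ((\<lambda>e. D e / L e) ` E)" "bdd_above ((\<lambda>e. R e / L e) ` E)"
    then have *: "(\<forall>e\<in>E. L e > 0) \<and> bdd_above ((\<lambda>e. D e / L e) ` E) \<and> bdd_above ((\<lambda>e. R e / L e) ` E)"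
      by blast
    note conv = converge_both_half_regions[of 1 ?SD ?SR ?SD, OF _ bounds(1-3)[OF *]]
    show "admittances_converge_locally_uniformly_on {z. Im z \<noteq> 0 \<and> ?SD < (cmod z)\<^sup>2} V E R L D a B"
      "limit_admittance V E R L D a B holomorphic_on {z. Im z \<noteq> 0 \<and> ?SD < (cmod z)\<^sup>2}"
      using conv bounds(3)[OF *] by simp_all
  next
    assume "\<forall>e\<in>E. L e > 0" "bdd_above ((\<lambda>e. D e / L e) ` E)" "bdd_above ((\<lambda>e. R e / L e) ` E)"
      and I: "0 < ?ID"
    then have *: "(\<forall>e\<in>E. L e > 0) \<and> bdd_above ((\<lambda>e. D e / L e) ` E) \<and> bdd_above ((\<lambda>e. R e / L e) ` E)"
      by blast
    note conv = converge_both_half_regions[of "-1" ?ID ?SR ?SD, OF _ bounds(1-3)[OF *]]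
    show "admittances_converge_locally_uniformly_on {z. Im z \<noteq> 0 \<and> (cmod z)\<^sup>2 < ?ID} V E R L D a B"
      "limit_admittance V E R L D a B holomorphic_on {z. Im z \<noteq> 0 \<and> (cmod z)\<^sup>2 < ?ID}"
      using conv I bounds(4)[OF *] by simp_all
  qed
qed

end
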